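(* Let $\Bbbk$ be an algebraically closed field of characteristic zero and let $V$ be a simple finite Novikov conformal algebra over $\Bbbk$. Then $V$ is isomorphic either to $\mathrm{Cur}_1$ or to $\mathcal V_\alpha$ for some $\alpha\in\Bbbk$.
   Context: Let $H=\Bbbk[\partial]$. A conformal algebra is an $H$-module $V$ with a $\Bbbk$-bilinear operation ($\lambda$-product) $V\times V\to V[\lambda]$, $(a,b)\mapsto a\circ_{(\lambda)}b$, which is sesqui-linear: $(\partial a)\circ_{(\lambda)}b=-\lambda(a\circ_{(\lambda)}b)$, $a\circ_{(\lambda)}(\partial b)=(\partial+\lambda)(a\circ_{(\lambda)}b)$. It is finite if it is finitely generated as an $H$-module. If $a\circ_{(\lambda)}b=\sum_n\lambda^n c_n$, put $\{a\circ_{(\lambda)}b\}=a\circ_{(-\partial-\lambda)}b:=\sum_n(-\partial-\lambda)^nc_n$. A Novikov conformal algebra is a conformal algebra such that for all $a,b,c\in V$ (products extended coefficientwise to polynomials) $$(a\circ_{(\lambda)}b)\circ_{(\lambda+\mu)}c-a\circ_{(\lambda)}(b\circ_{(\mu)}c)=(b\circ_{(\mu)}a)\circ_{(\lambda+\mu)}c-b\circ_{(\mu)}(a\circ_{(\lambda)}c),$$ $$(a\circ_{(\lambda)}b)\circ_{(\mu)}c=\{(a\circ_{(\lambda)}c)\circ_{(\mu-\lambda)}b\}.$$ An ideal of $V$ is an $H$-submodule $I$ with $I\circ_{(\lambda)}V\subseteq I[\lambda]$ and $V\circ_{(\lambda)}I\subseteq I[\lambda]$. $V$ is simple if $V\circ_{(\lambda)}V\neq0$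 and $V$ has no nonzero proper ideals. Isomorphisms are $H$-linear bijections preserving the $\lambda$-product. $\mathrm{Cur}_1=\mathrm{Cur}\,\Bbbk$ is the free $H$-module $Hv$ of rank one with $v\circ_{(\lambda)}v=v$. For $\alpha\in\Bbbk$, $\mathcal V_\alpha$ is the free $H$-module $Hv$ of rank one with $v\circ_{(\lambda)}v=(\partial+\lambda+\alpha)v$. (In both cases the $\lambda$-product is extended by sesqui-linearity.) *)

theory Defs
  imports "HOL-Computational_Algebra.Computational_Algebra"
begin

text \<open>
  For an additive group \<open>V\<close> of type \<open>'v\<close>, the group \<open>V[\<lambda>]\<close> is \<open>'v poly\<close>: multiplication by \<open>\<lambda>\<close> is
  \<open>pCons 0\<close>, and a map on \<open>V\<close> is extended coefficientwise by \<open>map_poly\<close>. The ring \<open>H = k[\<partial>]\<close> is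
  \<open>'k poly\<close>, and an \<open>H\<close>-module is an instance of the locale \<open>module\<close> with scalars \<open>'k poly\<close>.
\<close>

definition del :: "('k::field poly \<Rightarrow> 'v \<Rightarrow> 'v) \<Rightarrow> 'v \<Rightarrow> 'v"
  where "del scale a = scale [:0, 1:] a"

locale conformal_algebra = module scale
  for scale :: "'k::field poly \<Rightarrow> 'v::ab_group_add \<Rightarrow> 'v" +
  fixes lprod :: "'v \<Rightarrow> 'v \<Rightarrow> 'v poly"
  assumes lprod_add_left: "lprod (a + b) c = lprod a c + lprod b c"
    and lprod_add_right: "lprod a (b + c) = lprod a b + lprod a c"
    and lprod_scale_left: "lprod (scale [:t:] a) b = map_poly (scale [:t:]) (lprod a b)"
    and lprod_scale_right: "lprod a (scale [:t:] b) = map_poly (scale [:t:]) (lprod a b)"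
    and sesqui_left: "lprod (del scale a) b = - pCons 0 (lprod a b)"
    and sesqui_right:
      "lprod a (del scale b) = map_poly (del scale) (lprod a b) + pCons 0 (lprod a b)"
begin

definition finite_conformal :: bool
  where "finite_conformal \<longleftrightarrow> (\<exists>B. finite B \<and> span B = UNIV)"

definition conformal_ideal :: "'v set \<Rightarrow> bool"
  where "conformal_ideal I \<longleftrightarrow> subspace I \<and>
    (\<forall>a\<in>I. \<forall>b n. coeff (lprod a b) n \<in> I \<and> coeff (lprod b a) n \<in> I)"

definition simple_conformal :: bool
  where "simple_conformal \<longleftrightarrow> (\<exists>a b. lprod a b \<noteq> 0) \<and>
    (\<forall>I. conformal_ideal I \<longrightarrow> I = {0} \<or> I = UNIV)"

end

text \<open>
  \<open>V[\<lambda>,\<mu>]\<close> is \<open>'v poly poly\<close>, where the outer variable is \<open>\<lambda>\<close> and the inner one is \<open>\<mu>\<close>.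
  The following are the operators of multiplication by \<open>\<lambda>\<close>, \<open>\<mu>\<close> and \<open>\<partial>\<close> on it.
\<close>

definition mul_lam :: "'v::ab_group_add poly poly \<Rightarrow> 'v poly poly"
  where "mul_lam = pCons 0"

definition mul_mu :: "'v::ab_group_add poly poly \<Rightarrow> 'v poly poly"
  where "mul_mu = map_poly (pCons 0)"

definition mul_del ::
    "('k::field poly \<Rightarrow> 'v::ab_group_add \<Rightarrow> 'v) \<Rightarrow> 'v poly poly \<Rightarrow> 'v poly poly"
  where "mul_del scale = map_poly (map_poly (del scale))"

text \<open>
  For \<open>p = \<Sum>n. \<nu>\<^sup>n c\<^sub>n\<close>, the expression \<open>subst_op T F p\<close> is \<open>\<Sum>n. T\<^sup>n (F c\<^sub>n)\<close>: the map \<open>F\<close> is applied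
  to the coefficients, and multiplication by the variable \<open>\<nu>\<close> becomes the operator \<open>T\<close>.
\<close>

definition subst_op :: "('w \<Rightarrow> 'w) \<Rightarrow> ('v::ab_group_add \<Rightarrow> 'w::ab_group_add) \<Rightarrow> 'v poly \<Rightarrow> 'w"
  where "subst_op T F p = (\<Sum>n\<le>degree p. (T ^^ n) (F (coeff p n)))"

context conformal_algebra
begin

text \<open>The product \<open>a \<circ>\<^bsub>(T)\<^esub> b\<close> in \<open>V[\<lambda>,\<mu>]\<close>, where \<open>T\<close> is an operator such as \<open>\<lambda> + \<mu>\<close>.\<close>

definition lprod_at :: "('v poly poly \<Rightarrow> 'v poly poly) \<Rightarrow> 'v \<Rightarrow> 'v \<Rightarrow> 'v poly poly"
  where "lprod_at T a b = subst_op T (\<lambda>c. [:[:c:]:]) (lprod a b)"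

text \<open>The product \<open>{a \<circ>\<^bsub>(T)\<^esub> b} = a \<circ>\<^bsub>(-\<partial>-T)\<^esub> b\<close>.\<close>

definition rev_lprod_at :: "('v poly poly \<Rightarrow> 'v poly poly) \<Rightarrow> 'v \<Rightarrow> 'v \<Rightarrow> 'v poly poly"
  where "rev_lprod_at T a b = lprod_at (\<lambda>x. - mul_del scale x - T x) a b"

end

text \<open>
  The two sides of left symmetry are in this order:
  \<open>(a \<circ>\<^bsub>(\<lambda>)\<^esub> b) \<circ>\<^bsub>(\<lambda>+\<mu>)\<^esub> c - a \<circ>\<^bsub>(\<lambda>)\<^esub> (b \<circ>\<^bsub>(\<mu>)\<^esub> c) = (b \<circ>\<^bsub>(\<mu>)\<^esub> a) \<circ>\<^bsub>(\<lambda>+\<mu>)\<^esub> c - b \<circ>\<^bsub>(\<mu>)\<^esub> (a \<circ>\<^bsub>(\<lambda>)\<^esub> c)\<close>.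
  Right commutativity is \<open>(a \<circ>\<^bsub>(\<lambda>)\<^esub> b) \<circ>\<^bsub>(\<mu>)\<^esub> c = {(a \<circ>\<^bsub>(\<lambda>)\<^esub> c) \<circ>\<^bsub>(\<mu>-\<lambda>)\<^esub> b}\<close>; here the powers of \<open>\<lambda>\<close> coming
  from the inner product are mere coefficients, unaffected by the braces.
\<close>

locale novikov_conformal_algebra = conformal_algebra scale lprod
  for scale :: "'k::field poly \<Rightarrow> 'v::ab_group_add \<Rightarrow> 'v"
    and lprod :: "'v \<Rightarrow> 'v \<Rightarrow> 'v poly" +
  assumes left_symmetric:
    "subst_op mul_lam (\<lambda>d. lprod_at (\<lambda>x. mul_lam x + mul_mu x) d c) (lprod a b)
       - subst_op mul_mu (\<lambda>d. lprod_at mul_lam a d) (lprod b c)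
     = subst_op mul_mu (\<lambda>d. lprod_at (\<lambda>x. mul_lam x + mul_mu x) d c) (lprod b a)
       - subst_op mul_lam (\<lambda>d. lprod_at mul_mu b d) (lprod a c)"
    and right_commutative:
    "subst_op mul_lam (\<lambda>d. lprod_at mul_mu d c) (lprod a b)
     = subst_op mul_lam (\<lambda>d. rev_lprod_at (\<lambda>x. mul_mu x - mul_lam x) d b) (lprod a c)"

definition conformal_isomorphic ::
    "('k::field poly \<Rightarrow> 'v::ab_group_add \<Rightarrow> 'v) \<Rightarrow> ('v \<Rightarrow> 'v \<Rightarrow> 'v poly) \<Rightarrow>
     ('k poly \<Rightarrow> 'w::ab_group_add \<Rightarrow> 'w) \<Rightarrow> ('w \<Rightarrow> 'w \<Rightarrow> 'w poly) \<Rightarrow> bool"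
  where "conformal_isomorphic scale1 lprod1 scale2 lprod2 \<longleftrightarrow>
    (\<exists>f. module_hom scale1 scale2 f \<and> bij f \<and>
      (\<forall>a b. lprod2 (f a) (f b) = map_poly f (lprod1 a b)))"

text \<open>
  The free \<open>H\<close>-module \<open>Hv\<close> of rank one is \<open>'k poly\<close> with scalar multiplication \<open>(*)\<close> and \<open>v = 1\<close>.
  Here \<open>V[\<lambda>]\<close> is \<open>'k poly poly\<close> with outer variable \<open>\<lambda>\<close> and inner variable \<open>\<partial>\<close>. Given
  \<open>v \<circ>\<^bsub>(\<lambda>)\<^esub> v = p\<close>, sesqui-linearity forces \<open>fv \<circ>\<^bsub>(\<lambda>)\<^esub> gv = f(-\<lambda>) g(\<partial> + \<lambda>) p\<close>.
\<close>

definition eval_lam_del :: "'k::field poly \<Rightarrow> 'k poly poly \<Rightarrow> 'k poly poly"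
  where "eval_lam_del f q = poly (map_poly (\<lambda>c. [:[:c:]:]) f) q"

definition rank_one_lprod :: "'k::field poly poly \<Rightarrow> 'k poly \<Rightarrow> 'k poly \<Rightarrow> 'k poly poly"
  where "rank_one_lprod p f g = eval_lam_del f [:0, -1:] * eval_lam_del g [:[:0, 1:], 1:] * p"

definition cur1_lprod :: "'k::field poly \<Rightarrow> 'k poly \<Rightarrow> 'k poly poly"
  where "cur1_lprod = rank_one_lprod 1"

definition valpha_lprod :: "'k::field \<Rightarrow> 'k poly \<Rightarrow> 'k poly \<Rightarrow> 'k poly poly"
  where "valpha_lprod \<alpha> = rank_one_lprod [:[:\<alpha>, 1:], 1:]"

lemma eval_lam_del_pCons: "eval_lam_del (pCons c f) q = [:[:c:]:] + q * eval_lam_del f q"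
  by (simp add: eval_lam_del_def map_poly_pCons)

lemma eval_lam_del_0 [simp]: "eval_lam_del 0 q = 0"
  by (simp add: eval_lam_del_def)

lemma eval_lam_del_1 [simp]: "eval_lam_del 1 q = 1"
  using eval_lam_del_pCons[of 1 0 q] by (simp flip: one_pCons)

lemma eval_lam_del_add: "eval_lam_del (f + g) q = eval_lam_del f q + eval_lam_del g q"
proof (induction f g rule: poly_induct2)
  case 0
  then show ?case by simp
next
  case (pCons a p b r)
  have "[:[:a + b:]:] = [:[:a:]:] + [:[:b:]:]" by simp
  then show ?case using pCons by (simp only: add_pCons eval_lam_del_pCons) (simp add: algebra_simps)
qed

lemma eval_lam_del_smult: "eval_lam_del (smult t f) q = [:[:t:]:] * eval_lam_del f q"
proof (induction f)
  case 0
  then show ?case by simp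
next
  case (pCons a p)
  have "[:[:t * a:]:] = [:[:t:]:] * [:[:a:]:]" by simp
  then show ?case using pCons
    by (simp only: smult_pCons eval_lam_del_pCons) (simp add: algebra_simps)
qed

lemma rank_one_lprod_generator: "rank_one_lprod p 1 1 = p"
  by (simp add: rank_one_lprod_def)

lemma map_poly_mult_left: "map_poly ((*) c) p = smult c (p :: 'a::comm_semiring_0 poly)"
  by (intro poly_eqI) (simp add: coeff_map_poly)

lemma rank_one_conformal_algebra: "conformal_algebra (*) (rank_one_lprod p)"
proof
  fix a b c :: "'a poly" and t :: 'a
  show "rank_one_lprod p (a + b) c = rank_one_lprod p a c + rank_one_lprod p b c"
    and "rank_one_lprod p a (b + c) = rank_one_lprod p a b + rank_one_lprod p a c"
    by (simp_all add: rank_one_lprod_def eval_lam_del_add algebra_simps)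
  show "rank_one_lprod p ([:t:] * a) b = map_poly ((*) [:t:]) (rank_one_lprod p a b)"
    and "rank_one_lprod p a ([:t:] * b) = map_poly ((*) [:t:]) (rank_one_lprod p a b)"
    by (simp_all add: rank_one_lprod_def eval_lam_del_smult map_poly_mult_left)
  have del: "del (*) f = pCons 0 f" for f :: "'a poly"
    by (simp add: del_def)
  have map_del: "map_poly (del (*)) r = [:[:0, 1:]:] * r" for r :: "'a poly poly"
    by (intro poly_eqI) (simp add: coeff_map_poly del)
  have lam: "pCons 0 r = [:0, 1:] * r" for r :: "'a poly poly"
    by simp
  show "rank_one_lprod p (del (*) a) b = - pCons 0 (rank_one_lprod p a b)"
    by (simp add: rank_one_lprod_def del eval_lam_del_pCons)
  have "[:[:0, 1:], 1:] = [:[:0, 1:]:] + [:0, 1 :: 'a poly:]"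
    by simp
  then show "rank_one_lprod p a (del (*) b) =
      map_poly (del (*)) (rank_one_lprod p a b) + pCons 0 (rank_one_lprod p a b)"
    unfolding map_del lam[of "rank_one_lprod p a b"] rank_one_lprod_def del
    by (simp only: eval_lam_del_pCons) (simp add: algebra_simps)
qed (simp_all add: algebra_simps)

end

theory Submission
  imports Defs
begin

text \<open>
  Substituting elements of \<open>H = k[\<partial>]\<close> for \<open>\<lambda>\<close> turns the \<open>\<lambda>\<close>-product into operators on \<open>V\<close>. For
  \<open>t \<in> k\<close> let \<open>L\<^sub>t a\<close> be \<open>x \<mapsto> a \<circ>\<^bsub>(t)\<^esub> x\<close> and let \<open>R\<^sub>t b\<close> be \<open>x \<mapsto> x \<circ>\<^bsub>(-\<partial>-t)\<^esub> b\<close>; these are \<open>lmul t a\<close> and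
  \<open>rmul t b\<close> below. Both satisfy \<open>T\<partial> = (\<partial> + t)T\<close>, the right multiplications commute with each other,
  and left symmetry becomes \<open>[L\<^sub>s a, R\<^sub>t c] = R\<^sub>s\<^sub>+\<^sub>t (L\<^sub>s a c) - R\<^sub>t c R\<^sub>s a\<close>. So the left multiplications act as
  derivations on the commutative algebra generated by the right multiplications, as they do in an
  ordinary Novikov algebra, and this algebra is now graded by \<open>k\<close>. It is convenient to work in
  the larger algebra of the operators that commute with everything commuting with all \<open>R\<^sub>t b\<close>:
  it is commutative too, and stable under these derivations (\<open>graded_lbracket\<close>).

  In characteristic zero a derivation preserves nilpotency, so the images of the homogeneous nilpotent
  operators span an ideal of \<open>V\<close>. It is not all of \<open>V\<close>, because \<open>V\<close> is finitely generated; hence it is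
  zero. The generalized kernel of a homogeneous operator \<open>T\<close> is an ideal as well. Together this gives
  the main tool: a homogeneous operator is zero or injective (\<open>graded_eq_0_or_inj\<close>).

  An operator \<open>T\<close> of degree \<open>0\<close> is \<open>H\<close>-linear and so satisfies a polynomial equation over \<open>H\<close>. Conjugation
  by an injective operator of degree \<open>s\<close> shifts \<open>\<partial>\<close> by \<open>s\<close> in this equation, so that
  an equation of least degree in \<open>\<partial>\<close> has coefficients in \<open>k\<close>. Thus \<open>T\<close> has an eigenvalue \<open>c\<close>, and \<open>T - c\<close>,
  not being injective, is zero (\<open>graded_0_scalar\<close>). It follows that in each degree the homogeneous
  operators form a line spanned by a bijection.

  Let \<open>a\<close> have \<open>R\<^sub>t a = 0\<close> for all \<open>t\<close>. Comparing two commuting derivations \<open>ad (L\<^sub>u a)\<close> and \<open>ad (L\<^sub>2\<^sub>u a)\<close> on these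
  lines shows that one of them vanishes for each \<open>u \<noteq> 0\<close>. Since everything is polynomial in \<open>u\<close>, this
  makes the set of all such \<open>a\<close> an ideal, and this ideal is zero (\<open>rmul_kernel_eq_0\<close>). Now \<open>R\<^sub>t b\<close> and
  \<open>R\<^sub>t c\<close> are proportional for every \<open>t\<close>, with a ratio that is a rational function of \<open>t\<close>, which
  translates into an \<open>H\<close>-linear relation between \<open>b\<close> and \<open>c\<close>. So \<open>V\<close> is torsion-free of rank one, hence
  \<open>V = Hv\<close>. Bijectivity gives \<open>R\<^sub>t v v = q(t) v\<close> with \<open>q \<in> k[t]\<close>, the commutator formula above forces
  \<open>q\<close> to have degree at most one, and rescaling \<open>v\<close> yields the two cases.
\<close>

section \<open>Evaluation of polynomials with coefficients in the module\<close>

locale conformal_algebra_char_0 = conformal_algebra scale lprod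
  for scale :: "'k::field_char_0 poly \<Rightarrow> 'v::ab_group_add \<Rightarrow> 'v"
    and lprod :: "'v \<Rightarrow> 'v \<Rightarrow> 'v poly"
begin

definition ev :: "'k poly \<Rightarrow> 'v poly \<Rightarrow> 'v"
  where "ev f p = (\<Sum>n\<le>degree p. scale (f ^ n) (coeff p n))"

lemma ev_bound:
  assumes "degree p \<le> N"
  shows "ev f p = (\<Sum>n\<le>N. scale (f ^ n) (coeff p n))"
  unfolding ev_def
  by (rule sum.mono_neutral_left) (use assms in \<open>auto simp: coeff_eq_0\<close>)

lemma ev_0 [simp]: "ev f 0 = 0"
  by (simp add: ev_def)

lemma ev_pCons [simp]: "ev f (pCons a p) = a + scale f (ev f p)"
proof -
  have "ev f (pCons a p) = (\<Sum>n\<le>Suc (degree p). scale (f ^ n) (coeff (pCons a p) n))"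
    by (rule ev_bound) (simp add: degree_pCons_le)
  also have "\<dots> = a + scale f (ev f p)"
    by (simp add: sum.atMost_Suc_shift ev_def scale_sum_right del: sum.atMost_Suc)
  finally show ?thesis .
qed

lemma ev_add: "ev f (p + q) = ev f p + ev f q"
proof -
  define N where "N = max (degree p) (degree q)"
  have "degree p \<le> N" "degree q \<le> N" "degree (p + q) \<le> N"
    by (auto simp: N_def intro: degree_add_le)
  then show ?thesis
    by (simp add: ev_bound scale_right_distrib sum.distrib)
qed

lemma ev_minus: "ev f (- p) = - ev f p"
  by (metis add.right_inverse add_eq_0_iff ev_0 ev_add)

lemma ev_diff: "ev f (p - q) = ev f p - ev f q"
  using ev_add[of f "p - q" q] by simp

text \<open>
  Applied to \<open>\<partial>\<close>-linear maps, and also to maps such as \<open>d \<mapsto> d \<circ>\<^bsub>(g)\<^esub> c\<close>, which are only semilinear and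
  replace the point of evaluation \<open>f\<close> by another one.
\<close>

lemma ev_map_poly:
  assumes "\<And>x y. F (x + y) = F x + F y" and "\<And>x. F (scale f x) = scale g (F x)"
  shows "ev g (map_poly F p) = F (ev f p)"
proof -
  have F0: "F 0 = 0" using assms(1)[of 0 0] by simp
  show ?thesis
    by (induction p) (simp_all add: F0 map_poly_pCons assms)
qed

lemma ev_map_scale: "ev f (map_poly (scale h) p) = scale h (ev f p)"
  by (rule ev_map_poly) (simp_all add: scale_right_distrib mult.commute)

lemma ev_in_subspace:
  assumes "subspace I" and "\<And>n. coeff p n \<in> I"
  shows "ev f p \<in> I"
  unfolding ev_def using assms by (intro subspace_sum subspace_scale)

text \<open>
  Spans over \<open>k\<close> rather than over \<open>H\<close>: the multiples \<open>kv\<close> of a generator form such a subspace without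
  being a submodule.
\<close>

definition k_subspace :: "'v set \<Rightarrow> bool"
  where "k_subspace I \<longleftrightarrow> 0 \<in> I \<and> (\<forall>x\<in>I. \<forall>y\<in>I. x + y \<in> I) \<and> (\<forall>c. \<forall>x\<in>I. scale [:c:] x \<in> I)"

lemma k_subspaceD:
  assumes "k_subspace I"
  shows "0 \<in> I" and "x \<in> I \<Longrightarrow> y \<in> I \<Longrightarrow> x + y \<in> I" and "x \<in> I \<Longrightarrow> scale [:c:] x \<in> I"
    and "x \<in> I \<Longrightarrow> y \<in> I \<Longrightarrow> x - y \<in> I"
proof -
  show 1: "0 \<in> I" and 2: "x \<in> I \<Longrightarrow> y \<in> I \<Longrightarrow> x + y \<in> I" 
    and 3: "x \<in> I \<Longrightarrow> scale [:c:] x \<in> I" for x y c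
    using assms by (auto simp: k_subspace_def)
  have "- y = scale [:-1:] y" for y
    using scale_minus_left[of "[:1:]" y] by (simp add: scale_one[unfolded one_pCons])
  then show "x \<in> I \<Longrightarrow> y \<in> I \<Longrightarrow> x - y \<in> I"
    using 2[of x "-y"] 3[of y "-1"] by (metis diff_conv_add_uminus)
qed

lemma subspace_imp_k_subspace: "subspace I \<Longrightarrow> k_subspace I"
  by (simp add: k_subspace_def subspace_0 subspace_add subspace_scale)

lemma scale_const_add: "scale [:c + d:] x = scale [:c:] x + scale [:d:] x"
  using scale_left_distrib[of "[:c:]" "[:d:]" x] by simp

lemma scale_inverse_cancel: "c \<noteq> 0 \<Longrightarrow> scale [:inverse c:] (scale [:c:] x) = x"
  by (simp flip: one_pCons)

lemma ev_const_division:
  "\<exists>q r. degree q \<le> degree p - 1 \<and> (degree p = 0 \<longrightarrow> q = 0) \<and>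
    (\<forall>t. ev [:t:] p = scale [:t - t0:] (ev [:t:] q) + r)"
proof (induction p)
  case 0
  then show ?case by (intro exI[of _ 0]) simp
next
  case (pCons a p)
  from pCons.IH obtain q r where q: "degree q \<le> degree p - 1" "degree p = 0 \<longrightarrow> q = 0"
    and r: "\<And>t. ev [:t:] p = scale [:t - t0:] (ev [:t:] q) + r" by metis
  show ?case
  proof (cases "p = 0")
    case True
    then show ?thesis by (intro exI[of _ 0] exI[of _ a]) simp
  next
    case False
    have "ev [:t:] (pCons a p) = scale [:t - t0:] (ev [:t:] (pCons r q)) + (a + scale [:t0:] r)" for t
      by (simp add: r scale_right_distrib algebra_simps flip: scale_const_add)
    moreover have "degree (pCons r q) \<le> degree (pCons a p) - 1"
      using q \<open>p \<noteq> 0\<close> by (cases "q = 0") auto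
    ultimately show ?thesis using False by (metis degree_pCons_eq nat.distinct(1))
  qed
qed

text \<open>
  A polynomial with coefficients in \<open>V/I\<close> that has infinitely many roots in \<open>k\<close> vanishes on \<open>k\<close>; as usual, a
  root \<open>t\<^sub>0\<close> is split off by division by \<open>\<lambda> - t\<^sub>0\<close>.
\<close>

lemma ev_const_mem_all:
  assumes "k_subspace I" and "infinite {t. ev [:t:] p \<in> I}"
  shows "ev [:t:] p \<in> I"
proof -
  have "degree p \<le> N \<Longrightarrow> infinite {t. ev [:t:] p \<in> I} \<Longrightarrow> ev [:t:] p \<in> I" for N t
  proof (induction N arbitrary: p t)
    case 0
    obtain t1 where "ev [:t1:] p \<in> I" using 0(2) by (metis (mono_tags) infinite_imp_nonempty mem_Collect_eq subsetI subset_empty)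
    moreover obtain a where "p = [:a:]" using 0 by (metis degree_eq_zeroE le_zero_eq)
    ultimately show ?case by simp
  next
    case (Suc N)
    obtain t0 where t0: "ev [:t0:] p \<in> I"
      using Suc.prems(2) by (metis (mono_tags) infinite_imp_nonempty mem_Collect_eq subsetI subset_empty)
    obtain q r where q: "degree q \<le> degree p - 1"
      and r: "\<And>t. ev [:t:] p = scale [:t - t0:] (ev [:t:] q) + r" using ev_const_division[of p t0] by blast
    have r_mem: "r \<in> I" using t0 r[of t0] by simp
    have "{t. ev [:t:] p \<in> I} - {t0} \<subseteq> {t. ev [:t:] q \<in> I}"
    proof safe
      fix t assume t: "ev [:t:] p \<in> I" "t \<noteq> t0"
      have "scale [:t - t0:] (ev [:t:] q) \<in> I"
        using k_subspaceD(4)[OF assms(1) t(1) r_mem] by (simp add: r)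
      then have "scale [:inverse (t - t0):] (scale [:t - t0:] (ev [:t:] q)) \<in> I"
        by (rule k_subspaceD(3)[OF assms(1)])
      then show "ev [:t:] q \<in> I" using t(2) scale_inverse_cancel[of "t - t0"] by simp
    qed
    then have "infinite {t. ev [:t:] q \<in> I}"
      using Suc.prems(2) by (metis finite_Diff2 finite.emptyI finite_insert infinite_super)
    then have "ev [:t:] q \<in> I" using Suc.IH[of q t] q Suc.prems(1) by simp
    then show ?case unfolding r by (intro k_subspaceD[OF assms(1)] r_mem)
  qed
  then show ?thesis using assms(2) by blast
qed

text \<open>
  This is how polynomial identities in \<open>\<lambda>\<close> are replaced throughout by identities at the points of \<open>k\<close>,
  and conversely.
\<close>

lemma coeff_mem_if_ev_const_mem:
  assumes "k_subspace I" and "infinite {t. ev [:t:] p \<in> I}"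
  shows "coeff p n \<in> I"
proof -
  have "infinite {t. ev [:t:] p \<in> I} \<Longrightarrow> coeff p n \<in> I" for n
  proof (induction p arbitrary: n)
    case 0
    then show ?case using k_subspaceD(1)[OF assms(1)] by simp
  next
    case (pCons a p)
    have all: "ev [:t:] (pCons a p) \<in> I" for t
      by (rule ev_const_mem_all[OF assms(1) pCons.prems])
    have a: "a \<in> I" using all[of 0] by simp
    have "ev [:t:] p \<in> I" if "t \<noteq> 0" for t
    proof -
      have "scale [:t:] (ev [:t:] p) \<in> I"
        using k_subspaceD(4)[OF assms(1) all[of t] a] by simp
      then show ?thesis
        using k_subspaceD(3)[OF assms(1), of "scale [:t:] (ev [:t:] p)" "inverse t"]
          scale_inverse_cancel[OF that] by simp
    qed
    then have "UNIV - {0} \<subseteq> {t. ev [:t:] p \<in> I}" by auto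
    then have "infinite {t. ev [:t:] p \<in> I}"
      using infinite_UNIV_char_0[where 'a='k] by (metis finite_Diff2 finite.emptyI finite_insert infinite_super)
    then show ?case using pCons.IH a by (cases n) auto
  qed
  then show ?thesis using assms(2) by blast
qed

lemma k_subspace_0: "k_subspace {0}"
  by (simp add: k_subspace_def)

lemma poly_eq_0_if_ev_const_eq_0:
  assumes "infinite {t. ev [:t:] p = 0}"
  shows "p = 0"
  using coeff_mem_if_ev_const_mem[OF k_subspace_0, of p] assms by (intro poly_eqI) simp

lemma poly_eq_if_ev_const_eq:
  assumes "\<And>t. ev [:t:] p = ev [:t:] q"
  shows "p = q"
  using poly_eq_0_if_ev_const_eq_0[of "p - q"] infinite_UNIV_char_0[where 'a='k] 
  by (simp add: ev_diff assms)

text \<open>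
  The substitution \<open>\<lambda> \<mapsto> -\<partial> - \<lambda>\<close>, which exchanges \<open>a \<circ>\<^bsub>(\<lambda>)\<^esub> b\<close> and \<open>{a \<circ>\<^bsub>(\<lambda>)\<^esub> b}\<close>. It is an involution, so
  the roles of \<open>p\<close> and \<open>q\<close> can be exchanged.
\<close>

lemma ev_reversal: "\<exists>q. \<forall>f. ev f q = ev (- [:0, 1:] - f) p"
proof (induction p)
  case 0
  then show ?case by (intro exI[of _ 0]) simp
next
  case (pCons a p)
  then obtain q where q: "\<And>f. ev f q = ev (- [:0, 1:] - f) p" by blast
  have "ev f (pCons a 0 - map_poly (scale [:0, 1:]) q - pCons 0 q) = ev (- [:0, 1:] - f) (pCons a p)" for f
    by (simp only: ev_diff ev_pCons ev_map_scale ev_0 q scale_left_diff_distrib scale_minus_left)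
      (simp only: scale_zero_right add_0_right add_0_left diff_conv_add_uminus add.assoc)
  then show ?case by blast
qed

section \<open>Products at an element of the coefficient ring\<close>

definition prod_at :: "'k poly \<Rightarrow> 'v \<Rightarrow> 'v \<Rightarrow> 'v"
  where "prod_at f a b = ev f (lprod a b)"

lemma prod_at_add_left: "prod_at f (a + b) c = prod_at f a c + prod_at f b c"
  by (simp add: prod_at_def lprod_add_left ev_add)

lemma prod_at_add_right: "prod_at f a (b + c) = prod_at f a b + prod_at f a c"
  by (simp add: prod_at_def lprod_add_right ev_add)

lemma pCons_decomp: "pCons c h = [:c:] + [:0, 1:] * (h :: 'k poly)"
  by simp

lemma prod_at_0_left [simp]: "prod_at f 0 b = 0" and prod_at_0_right [simp]: "prod_at f b 0 = 0"
  using prod_at_add_left[of f 0 0 b] prod_at_add_right[of f b 0 0] by simp_all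

lemma prod_at_scale_left: "prod_at f (scale h a) b = scale (pcompose h (- f)) (prod_at f a b)"
proof (induction h arbitrary: a)
  case 0
  then show ?case by simp
next
  case (pCons c h)
  have "prod_at f (scale (pCons c h) a) b = prod_at f (scale [:c:] a) b + prod_at f (del scale (scale h a)) b"
    by (simp only: pCons_decomp[of c h] scale_left_distrib prod_at_add_left del_def scale_scale)
  also have "\<dots> = scale [:c:] (prod_at f a b) - scale f (prod_at f (scale h a) b)"
    by (simp add: prod_at_def lprod_scale_left sesqui_left ev_map_scale ev_minus)
  finally show ?case
    by (simp only: pCons pcompose_pCons scale_left_distrib scale_scale mult_minus_left scale_minus_left)
      (simp only: diff_conv_add_uminus)
qed

lemma prod_at_del_right: "prod_at f a (del scale b) = scale (f + [:0, 1:]) (prod_at f a b)"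
proof -
  have "prod_at f a (del scale b) = del scale (prod_at f a b) + scale f (prod_at f a b)"
    unfolding prod_at_def sesqui_right ev_add ev_pCons unfolding del_def[abs_def] ev_map_scale by simp
  then show ?thesis
    by (simp only: del_def scale_left_distrib add.commute)
qed

lemma prod_at_scale_right: "prod_at f a (scale h b) = scale (pcompose h (f + [:0, 1:])) (prod_at f a b)"
proof (induction h arbitrary: b)
  case 0
  then show ?case by simp
next
  case (pCons c h)
  have "prod_at f a (scale (pCons c h) b) = prod_at f a (scale [:c:] b) + prod_at f a (del scale (scale h b))"
    by (simp only: pCons_decomp[of c h] scale_left_distrib prod_at_add_right del_def scale_scale)
  also have "\<dots> = scale [:c:] (prod_at f a b) + scale (f + [:0, 1:]) (prod_at f a (scale h b))"
    by (simp only: prod_at_del_right) (simp only: prod_at_def lprod_scale_right ev_map_scale)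
  finally show ?case
    by (simp only: pCons pcompose_pCons scale_left_distrib scale_scale)
qed

end

context conformal_algebra_char_0
begin

section \<open>Evaluation of polynomials in two variables\<close>

definition ev2 :: "'k poly \<Rightarrow> 'k poly \<Rightarrow> 'v poly poly \<Rightarrow> 'v"
  where "ev2 f g P = ev f (map_poly (ev g) P)"

lemma ev2_add: "ev2 f g (P + Q) = ev2 f g P + ev2 f g Q"
proof -
  have "map_poly (ev g) (P + Q) = map_poly (ev g) P + map_poly (ev g) Q"
    by (intro poly_eqI) (simp add: coeff_map_poly ev_add)
  then show ?thesis by (simp add: ev2_def ev_add)
qed

lemma ev2_0 [simp]: "ev2 f g 0 = 0"
  by (simp add: ev2_def)

lemma ev2_minus: "ev2 f g (- P) = - ev2 f g P"
  by (metis add.right_inverse add_eq_0_iff ev2_0 ev2_add)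

lemma ev2_diff: "ev2 f g (P - Q) = ev2 f g P - ev2 f g Q"
  using ev2_add[of f g "P - Q" Q] by simp

lemma ev2_const: "ev2 f g [:[:c:]:] = c"
  by (simp add: ev2_def map_poly_pCons)

lemma ev2_mul_lam: "ev2 f g (mul_lam P) = scale f (ev2 f g P)"
  by (simp add: ev2_def mul_lam_def map_poly_pCons)

lemma ev2_mul_mu: "ev2 f g (mul_mu P) = scale g (ev2 f g P)"
proof -
  have "map_poly (ev g) (mul_mu P) = map_poly (scale g) (map_poly (ev g) P)"
    by (intro poly_eqI) (simp add: coeff_map_poly mul_mu_def)
  then show ?thesis by (simp add: ev2_def ev_map_scale)
qed

lemma ev2_mul_del: "ev2 f g (mul_del scale P) = scale [:0, 1:] (ev2 f g P)"
proof -
  have "map_poly (ev g) (mul_del scale P) = map_poly (scale [:0, 1:]) (map_poly (ev g) P)"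
    by (intro poly_eqI) (simp add: coeff_map_poly mul_del_def del_def[abs_def] ev_map_scale)
  then show ?thesis by (simp add: ev2_def ev_map_scale)
qed

text \<open>
  With the next two lemmas, evaluation at \<open>\<lambda> = f\<close>, \<open>\<mu> = g\<close> carries each term of the defining
  identities to a product at an element of \<open>H\<close>.
\<close>

lemma ev2_subst_op:
  assumes T: "\<And>x. ev2 f g (T x) = scale h (ev2 f g x)"
    and G: "\<And>c. ev2 f g (F c) = G c" and G0: "G 0 = 0"
  shows "ev2 f g (subst_op T F p) = ev h (map_poly G p)"
proof -
  have pow: "ev2 f g ((T ^^ n) x) = scale (h ^ n) (ev2 f g x)" for n x
    by (induction n) (simp_all add: T)
  have sum: "ev2 f g (sum u A) = (\<Sum>n\<in>A. ev2 f g (u n))" for u and A :: "nat set"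
    by (induction A rule: infinite_finite_induct) (simp_all add: ev2_add)
  have "ev2 f g (subst_op T F p) = (\<Sum>n\<le>degree p. scale (h ^ n) (G (coeff p n)))"
    by (simp add: subst_op_def sum pow G)
  also have "\<dots> = ev h (map_poly G p)"
    using ev_bound[OF map_poly_degree_leq[of G p], of h] G0 by (simp add: coeff_map_poly)
  finally show ?thesis .
qed

lemma ev2_lprod_at:
  assumes "\<And>x. ev2 f g (T x) = scale h (ev2 f g x)"
  shows "ev2 f g (lprod_at T a b) = prod_at h a b"
  unfolding lprod_at_def prod_at_def
  by (subst ev2_subst_op[where G = "\<lambda>c. c", OF assms ev2_const]) simp_all

lemma ev2_rev_lprod_at:
  assumes "\<And>x. ev2 f g (T x) = scale h (ev2 f g x)"
  shows "ev2 f g (rev_lprod_at T a b) = prod_at (- [:0, 1:] - h) a b"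
  unfolding rev_lprod_at_def
  by (rule ev2_lprod_at) (simp only: ev2_diff ev2_minus ev2_mul_del assms scale_left_diff_distrib scale_minus_left)

lemma prod_at_ev_left: "prod_at g (ev h p) c = ev (pcompose h (- g)) (map_poly (\<lambda>d. prod_at g d c) p)"
  by (rule ev_map_poly[symmetric]) (simp_all add: prod_at_add_left prod_at_scale_left)

lemma prod_at_ev_right: "prod_at g a (ev h p) = ev (pcompose h (g + [:0, 1:])) (map_poly (prod_at g a) p)"
  by (rule ev_map_poly[symmetric]) (simp_all only: prod_at_add_right prod_at_scale_right)

section \<open>Left and right multiplication operators\<close>

definition lmul :: "'k \<Rightarrow> 'v \<Rightarrow> 'v \<Rightarrow> 'v"
  where "lmul t a x = prod_at [:t:] a x"

text \<open>
  The shift to \<open>-\<partial> - t\<close> makes \<open>x \<mapsto> x \<circ> b\<close> satisfy the same rule \<open>T\<partial> = (\<partial> + t)T\<close> as left multiplication at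
  \<open>t\<close>, and it is for these operators that right commutativity is plain commutativity.
\<close>

definition rmul :: "'k \<Rightarrow> 'v \<Rightarrow> 'v \<Rightarrow> 'v"
  where "rmul t b x = prod_at [:- t, -1:] x b"

definition twisted :: "'k \<Rightarrow> ('v \<Rightarrow> 'v) \<Rightarrow> bool"
  where "twisted t T \<longleftrightarrow> (\<forall>x y. T (x + y) = T x + T y) \<and>
    (\<forall>h x. T (scale h x) = scale (pcompose h [:t, 1:]) (T x))"

lemma twistedD:
  assumes "twisted t T"
  shows "T (x + y) = T x + T y" "T (scale h x) = scale (pcompose h [:t, 1:]) (T x)"
    "T 0 = 0" "T (- x) = - T x" "T (x - y) = T x - T y" "T (scale [:c:] x) = scale [:c:] (T x)"
proof -
  show add: "T (x + y) = T x + T y" for x y using assms by (simp add: twisted_def)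
  show scale: "T (scale h x) = scale (pcompose h [:t, 1:]) (T x)" for h using assms by (simp add: twisted_def)
  show 0: "T 0 = 0" using scale[of 0] by simp
  show minus: "T (- x) = - T x" for x using add[of x "-x"] 0 by (simp add: eq_neg_iff_add_eq_0 add.commute)
  show "T (x - y) = T x - T y" using add[of x "-y"] minus[of y] by simp
  show "T (scale [:c:] x) = scale [:c:] (T x)" using scale[of "[:c:]"] by simp
qed

lemma twisted_lmul: "twisted t (lmul t a)"
  unfolding twisted_def lmul_def by (simp add: prod_at_add_right prod_at_scale_right)

lemma twisted_rmul: "twisted t (rmul t b)"
  unfolding twisted_def rmul_def by (simp add: prod_at_add_left prod_at_scale_left)

lemma rmul_add_right: "rmul t (a + b) x = rmul t a x + rmul t b x"
  by (simp add: rmul_def prod_at_add_right)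

lemma rmul_scale: "rmul t (scale h b) x = scale [:poly h (- t):] (rmul t b x)"
proof -
  have "pcompose h [:- t:] = [:poly h (- t):]" by (induction h) (simp_all add: pcompose_pCons)
  then show ?thesis by (simp add: rmul_def prod_at_scale_right)
qed

lemma lmul_scale: "lmul t (scale h a) x = scale [:poly h (- t):] (lmul t a x)"
proof -
  have "pcompose h [:- t:] = [:poly h (- t):]" by (induction h) (simp_all add: pcompose_pCons)
  then show ?thesis by (simp add: lmul_def prod_at_scale_left)
qed

lemma lmul_eq_ev: "lmul t a x = ev [:t:] (lprod a x)"
  by (simp add: lmul_def prod_at_def)

lemma rmul_eq_ev: "\<exists>p. \<forall>t. rmul t b x = ev [:t:] p"
proof -
  obtain q where "\<And>f. ev f q = ev (- [:0, 1:] - f) (lprod x b)"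
    using ev_reversal by metis
  moreover have "[:- t, -1:] = - [:0, 1:] - [:t:]" for t :: 'k by simp
  ultimately show ?thesis unfolding rmul_def prod_at_def by metis
qed

text \<open>
  Reversal is applied twice: the values \<open>R\<^sub>t b x\<close> determine the reversed polynomial, and reversing it
  gives back \<open>x \<circ>\<^bsub>(\<lambda>)\<^esub> b\<close>.
\<close>

lemma coeff_mem_if_rmul_mem:
  assumes "subspace I" "\<And>t. rmul t b x \<in> I"
  shows "coeff (lprod x b) n \<in> I"
proof -
  obtain q where q: "\<And>f. ev f q = ev (- [:0, 1:] - f) (lprod x b)"
    using ev_reversal by metis
  have "ev [:t:] q \<in> I" for t using assms(2)[of t] by (simp add: q rmul_def prod_at_def)
  then have "\<And>n. coeff q n \<in> I"
    by (intro coeff_mem_if_ev_const_mem[OF subspace_imp_k_subspace[OF assms(1)]]) (simp add: infinite_UNIV_char_0)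
  \<comment> \<open>The coefficients of the reversed polynomial lie in \<open>I\<close>, hence so do its values at all elements of \<open>H\<close>.\<close>
  then have "ev (- [:0, 1:] - [:t:]) q \<in> I" for t by (intro ev_in_subspace assms)
  then have "ev [:t:] (lprod x b) \<in> I" for t by (simp add: q)
  then show ?thesis
    by (intro coeff_mem_if_ev_const_mem[OF subspace_imp_k_subspace[OF assms(1)]]) (simp add: infinite_UNIV_char_0)
qed

lemma conformal_idealI:
  assumes "subspace I" "\<And>t a x. x \<in> I \<Longrightarrow> lmul t a x \<in> I" "\<And>t b x. x \<in> I \<Longrightarrow> rmul t b x \<in> I"
  shows "conformal_ideal I"
  unfolding conformal_ideal_def
proof safe
  fix a b n assume "a \<in> I"
  show "coeff (lprod a b) n \<in> I" by (rule coeff_mem_if_rmul_mem) (use assms \<open>a \<in> I\<close> in auto)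
  have "ev [:t:] (lprod b a) \<in> I" for t using assms(2)[OF \<open>a \<in> I\<close>, of t b] by (simp add: lmul_eq_ev)
  then show "coeff (lprod b a) n \<in> I"
    by (intro coeff_mem_if_ev_const_mem[OF subspace_imp_k_subspace[OF assms(1)]]) (simp add: infinite_UNIV_char_0)
qed (fact assms(1))

end

section \<open>The Novikov identities for multiplication operators\<close>

locale novikov_char_0 = novikov_conformal_algebra scale lprod
  for scale :: "'k::field_char_0 poly \<Rightarrow> 'v::ab_group_add \<Rightarrow> 'v"
    and lprod :: "'v \<Rightarrow> 'v \<Rightarrow> 'v poly"

sublocale novikov_char_0 \<subseteq> conformal_algebra_char_0 ..

context novikov_char_0
begin

lemma left_symmetric_at:
  "ev f (map_poly (\<lambda>d. prod_at (f + g) d c) (lprod a b)) - ev g (map_poly (prod_at f a) (lprod b c)) =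
   ev g (map_poly (\<lambda>d. prod_at (f + g) d c) (lprod b a)) - ev f (map_poly (prod_at g b) (lprod a c))"
proof -
  have lm: "ev2 f g (mul_lam x + mul_mu x) = scale (f + g) (ev2 f g x)" for x
    by (simp add: ev2_add ev2_mul_lam ev2_mul_mu scale_left_distrib)
  show ?thesis
    using arg_cong[OF left_symmetric[of c a b], of "ev2 f g"] unfolding ev2_diff
    by (simp add: ev2_subst_op[OF ev2_mul_lam ev2_lprod_at] ev2_subst_op[OF ev2_mul_mu ev2_lprod_at]
      lm ev2_mul_lam ev2_mul_mu)
qed

lemma right_commutative_at:
  "ev f (map_poly (\<lambda>d. prod_at g d c) (lprod a b)) =
   ev f (map_poly (\<lambda>d. prod_at (- [:0, 1:] - (g - f)) d b) (lprod a c))"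
proof -
  have lm: "ev2 f g (mul_mu x - mul_lam x) = scale (g - f) (ev2 f g x)" for x
    by (simp add: ev2_diff ev2_mul_lam ev2_mul_mu scale_left_diff_distrib)
  show ?thesis
    using arg_cong[OF right_commutative[of c a b], of "ev2 f g"]
    by (simp add: ev2_subst_op[OF ev2_mul_lam ev2_lprod_at] ev2_subst_op[OF ev2_mul_lam ev2_rev_lprod_at]
      lm ev2_mul_mu)
qed

text \<open>
  Right commutativity at \<open>\<lambda> = -\<partial> - s - t\<close>, \<open>\<mu> = -\<partial> - s\<close>.
\<close>

lemma rmul_commute: "rmul s c (rmul t b x) = rmul t b (rmul s c x)"
proof -
  have "rmul s c (rmul t b x) = ev [:- s - t, -1:] (map_poly (\<lambda>d. prod_at [:- s, -1:] d c) (lprod x b))"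
    unfolding rmul_def by (subst prod_at_def[of _ x], subst prod_at_ev_left) (simp add: pcompose_pCons algebra_simps)
  also have "\<dots> = ev [:- s - t, -1:] (map_poly (\<lambda>d. prod_at [:- t, -1:] d b) (lprod x c))"
    by (subst right_commutative_at) simp
  also have "\<dots> = rmul t b (rmul s c x)"
    unfolding rmul_def by (subst prod_at_def[of _ x], subst prod_at_ev_left) (simp add: pcompose_pCons algebra_simps)
  finally show ?thesis .
qed

text \<open>
  Left symmetry at \<open>\<lambda> = s\<close>, \<open>\<mu> = -\<partial> - s - t\<close>. The right-hand side is built from right multiplications only;
  this is what makes left multiplications act as derivations of the algebra they generate.
\<close>

lemma lmul_rmul_commutator:
  "lmul s a (rmul t c x) - rmul t c (lmul s a x) = rmul (s + t) (lmul s a c) x - rmul t c (rmul s a x)"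
proof -
  let ?g = "[:- s - t, -1:]"
  have 1: "rmul t c (lmul s a x) = ev [:s:] (map_poly (\<lambda>d. prod_at [:- t, -1:] d c) (lprod a x))"
    unfolding rmul_def lmul_def by (subst prod_at_def[of _ a], subst prod_at_ev_left) simp
  have 2: "lmul s a (rmul t c x) = ev ?g (map_poly (prod_at [:s:] a) (lprod x c))"
    unfolding rmul_def lmul_def by (subst prod_at_def[of _ x], subst prod_at_ev_right) (simp add: pcompose_pCons algebra_simps)
  have 3: "rmul t c (rmul s a x) = ev ?g (map_poly (\<lambda>d. prod_at [:- t, -1:] d c) (lprod x a))"
    unfolding rmul_def by (subst prod_at_def[of _ x], subst prod_at_ev_left) (simp add: pcompose_pCons algebra_simps)
  have 4: "rmul (s + t) (lmul s a c) x = ev [:s:] (map_poly (prod_at ?g x) (lprod a c))"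
    unfolding rmul_def lmul_def by (subst prod_at_def[of _ a], subst prod_at_ev_right) (simp add: algebra_simps)
  show ?thesis
    using left_symmetric_at[of "[:s:]" ?g c a x] unfolding 1 2 3 4 by (simp add: algebra_simps)
qed

text \<open>
  Left symmetry at \<open>\<lambda> = s\<close>, \<open>\<mu> = t\<close>.
\<close>

lemma lmul_commutator:
  "lmul s a (lmul t b x) - lmul t b (lmul s a x) = lmul (s + t) (lmul s a b) x - lmul (s + t) (lmul t b a) x"
proof -
  have 1: "lmul (s + t) (lmul s a b) x = ev [:s:] (map_poly (\<lambda>d. prod_at [:s + t:] d x) (lprod a b))" for s t a b
    unfolding lmul_def by (subst prod_at_def[of _ a], subst prod_at_ev_left) simp
  have 2: "lmul s a (lmul t b x) = ev [:t:] (map_poly (prod_at [:s:] a) (lprod b x))" for s t a b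
    unfolding lmul_def by (subst prod_at_def[of _ b], subst prod_at_ev_right) simp
  show ?thesis
    using left_symmetric_at[of "[:s:]" "[:t:]" x a b] 1[of s t a b] 1[of t s b a] 
    unfolding 2 by (simp add: algebra_simps)
qed

end

section \<open>Homogeneous operators and their derivations\<close>

context conformal_algebra_char_0
begin

lemma subspace_kernel: "twisted t T \<Longrightarrow> subspace {x. T x = 0}"
  by (intro subspaceI) (simp_all add: twistedD[of t T])

lemma twisted_image_span:
  assumes "twisted t T" and "\<And>x. x \<in> A \<Longrightarrow> T x \<in> span A" and "x \<in> span A"
  shows "T x \<in> span A"
proof -
  have "subspace {x. T x \<in> span A}"
    by (intro subspaceI) (simp_all add: twistedD[OF assms(1)] span_add span_scale span_zero)
  then have "span A \<subseteq> {x. T x \<in> span A}"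
    by (intro span_minimal) (use assms(2) in auto)
  then show ?thesis using assms(3) by blast
qed

lemma twisted_comp:
  assumes "twisted s S" and "twisted t T"
  shows "twisted (s + t) (\<lambda>x. S (T x))"
proof -
  have "pcompose (pcompose h [:t, 1:]) [:s, 1:] = pcompose h [:s + t, 1:]" for h :: "'k poly"
    by (simp add: pcompose_assoc[symmetric] pcompose_pCons add.commute)
  then show ?thesis
    unfolding twisted_def by (simp add: twistedD[OF assms(1)] twistedD[OF assms(2)])
qed

lemma twisted_id: "twisted 0 (\<lambda>x. x)"
proof -
  have "pcompose h [:0, 1:] = h" for h :: "'k poly" by (rule pcompose_idR)
  then show ?thesis unfolding twisted_def by simp
qed

lemma twisted_add:
  assumes "twisted t S" and "twisted t T"
  shows "twisted t (\<lambda>x. S x + T x)"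
  unfolding twisted_def by (simp add: twistedD[OF assms(1)] twistedD[OF assms(2)] scale_right_distrib)

lemma twisted_diff:
  assumes "twisted t S" and "twisted t T"
  shows "twisted t (\<lambda>x. S x - T x)"
  unfolding twisted_def by (simp add: twistedD[OF assms(1)] twistedD[OF assms(2)] scale_right_diff_distrib)

lemma twisted_scale:
  assumes "twisted t T"
  shows "twisted t (\<lambda>x. scale [:c:] (T x))"
  unfolding twisted_def by (simp add: twistedD[OF assms(1)] scale_right_distrib mult.commute)

text \<open>
  The algebra of right multiplications is enlarged to its bicommutant, whose homogeneous elements are
  the \<open>graded\<close> operators. This describes an algebra closed under products and derivations without
  generating it step by step.
\<close>

definition rmul_centralizer :: "('v \<Rightarrow> 'v) set"
  where "rmul_centralizer = {X. (\<forall>x y. X (x + y) = X x + X y) \<and>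
    (\<forall>c x. X (scale [:c:] x) = scale [:c:] (X x)) \<and> (\<forall>t b x. X (rmul t b x) = rmul t b (X x))}"

definition graded :: "'k \<Rightarrow> ('v \<Rightarrow> 'v) \<Rightarrow> bool"
  where "graded t T \<longleftrightarrow> twisted t T \<and> (\<forall>X\<in>rmul_centralizer. \<forall>x. X (T x) = T (X x))"

definition lbracket :: "'k \<Rightarrow> 'v \<Rightarrow> ('v \<Rightarrow> 'v) \<Rightarrow> 'v \<Rightarrow> 'v"
  where "lbracket s a T x = lmul s a (T x) - T (lmul s a x)"

definition nilpotent :: "('v \<Rightarrow> 'v) \<Rightarrow> bool"
  where "nilpotent T \<longleftrightarrow> (\<exists>n. \<forall>x. (T ^^ n) x = 0)"

lemma graded_twisted: "graded t T \<Longrightarrow> twisted t T"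
  by (simp add: graded_def)

lemma graded_rmul: "graded t (rmul t b)"
  by (auto simp: graded_def twisted_rmul rmul_centralizer_def)

lemma graded_comp:
  assumes "graded s S" and "graded t T"
  shows "graded (s + t) (\<lambda>x. S (T x))"
  using assms by (simp add: graded_def twisted_comp)

lemma graded_id: "graded 0 (\<lambda>x. x)"
  by (simp add: graded_def twisted_id)

lemma graded_diff:
  assumes "graded t S" and "graded t T"
  shows "graded t (\<lambda>x. S x - T x)"
proof -
  have "X (S x - T x) = X (S x) - X (T x)" if "X \<in> rmul_centralizer" for X x
  proof -
    have "X (S x - T x) + X (T x) = X (S x)"
      using that unfolding rmul_centralizer_def by (metis (mono_tags, lifting) mem_Collect_eq diff_add_cancel)
    then show ?thesis by (simp add: algebra_simps)
  qed
  then show ?thesis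
    using assms by (simp add: graded_def twisted_diff)
qed

lemma graded_scale: "graded t T \<Longrightarrow> graded t (\<lambda>x. scale [:c:] (T x))"
  by (simp add: graded_def twisted_scale rmul_centralizer_def)

lemma graded_funpow: "graded t T \<Longrightarrow> graded (of_nat n * t) (T ^^ n)"
proof (induction n)
  case 0
  then show ?case using graded_id by (simp add: id_def)
next
  case (Suc n)
  then show ?case using graded_comp[of t T "of_nat n * t" "T ^^ n"] 
    by (simp add: o_def algebra_simps)
qed

end

context novikov_char_0
begin

lemma graded_in_centralizer: "graded t T \<Longrightarrow> T \<in> rmul_centralizer"
proof -
  assume T: "graded t T"
  have "rmul s b \<in> rmul_centralizer" for s b
    using rmul_commute by (simp add: rmul_centralizer_def twistedD[OF twisted_rmul])
  then show ?thesis
    using T twistedD[OF graded_twisted[OF T]] by (auto simp: rmul_centralizer_def graded_def)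
qed

lemma graded_commute: "graded s S \<Longrightarrow> graded t T \<Longrightarrow> S (T x) = T (S x)"
  using graded_in_centralizer unfolding graded_def by blast

lemma lbracket_rmul: "lbracket s a (rmul t c) x = rmul (s + t) (lmul s a c) x - rmul t c (rmul s a x)"
  by (simp add: lbracket_def lmul_rmul_commutator)

text \<open>
  If \<open>X\<close> commutes with all right multiplications, so does \<open>Y = [X, L]\<close>, because \<open>[L, R]\<close> is again in the
  algebra of right multiplications. Then \<open>[X, [L, T]] = [Y, T] + [L, [X, T]] = 0\<close> by the Jacobi identity.
\<close>

lemma graded_lbracket:
  assumes T: "graded t T"
  shows "graded (s + t) (lbracket s a T)"
  unfolding graded_def
proof (intro conjI ballI allI)
  have tw: "twisted (s + t) (\<lambda>x. T (lmul s a x))"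
    using twisted_comp[OF graded_twisted[OF T] twisted_lmul] by (simp add: add.commute)
  show "twisted (s + t) (lbracket s a T)"
    unfolding lbracket_def[abs_def]
    by (intro twisted_diff tw twisted_comp twisted_lmul graded_twisted T)
next
  fix X x assume X: "X \<in> rmul_centralizer"
  then have add: "X (x + y) = X x + X y" for x y by (simp add: rmul_centralizer_def)
  have X0: "X 0 = 0" using add[of 0 0] by simp
  have diff: "X (x - y) = X x - X y" for x y
    using add[of "x - y" y] by (simp add: algebra_simps)
  have XR: "X (rmul t b x) = rmul t b (X x)" for t b x
    using X by (simp add: rmul_centralizer_def)
  have XT: "X (T x) = T (X x)" for x using X T by (simp add: graded_def)
  define Y where "Y = (\<lambda>x. X (lmul s a x) - lmul s a (X x))"
  have "Y (rmul t b x) = rmul t b (Y x)" for t b x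
  proof -
    have "X (lbracket s a (rmul t b) x) = lbracket s a (rmul t b) (X x)"
      by (simp add: lbracket_rmul diff XR)
    then show ?thesis
      by (simp add: Y_def XR diff lbracket_def twistedD[OF twisted_rmul] algebra_simps)
  qed
  then have "Y \<in> rmul_centralizer"
    using X by (simp add: rmul_centralizer_def Y_def twistedD[OF twisted_lmul] scale_right_diff_distrib)
  then have "Y (T x) = T (Y x)" using T by (simp add: graded_def)
  then show "X (lbracket s a T x) = lbracket s a T (X x)"
    by (simp add: Y_def lbracket_def diff XT twistedD[OF graded_twisted[OF T]] algebra_simps)
qed

text \<open>
  The power rule \<open>D(T\<^sup>n) = n T\<^sup>n\<^sup>-\<^sup>1 D(T)\<close> for the derivation \<open>D = [L, \<cdot>]\<close>.
\<close>

lemma lmul_funpow: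
  assumes T: "graded t T"
  shows "lmul s a ((T ^^ n) x) =
    (T ^^ n) (lmul s a x) + scale [:of_nat n:] ((T ^^ (n - 1)) (lbracket s a T x))"
proof (induction n)
  case 0
  then show ?case by simp
next
  case (Suc n)
  let ?U = "lbracket s a T"
  have "lmul s a ((T ^^ Suc n) x) = T (lmul s a ((T ^^ n) x)) + ?U ((T ^^ n) x)"
    by (simp add: lbracket_def)
  also have "?U ((T ^^ n) x) = (T ^^ n) (?U x)"
    by (rule graded_commute[OF graded_lbracket[OF T] graded_funpow[OF T]])
  also have "T (lmul s a ((T ^^ n) x)) = (T ^^ Suc n) (lmul s a x) + scale [:of_nat n:] ((T ^^ n) (?U x))"
    unfolding Suc twistedD[OF graded_twisted[OF T]] by (cases n) simp_all
  finally show ?case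
    using scale_const_add[of "of_nat n" 1] scale_one[unfolded one_pCons] by (simp add: add.assoc add.commute)
qed

lemma scale_const_eq_0: "scale [:c:] x = 0 \<longleftrightarrow> c = 0 \<or> x = 0"
proof (cases "c = 0")
  case False
  then show ?thesis using scale_inverse_cancel[OF False, of x] scale_zero_right by metis
qed simp

text \<open>
  Applying \<open>D\<close> to \<open>T\<^sup>m\<^sup>+\<^sup>1 U\<^sup>k = 0\<close> with \<open>U = D(T)\<close>, and multiplying by \<open>U\<close>, gives \<open>(m + 1) T\<^sup>m U\<^sup>k\<^sup>+\<^sup>2 = 0\<close>, since
  the other term contains \<open>T\<^sup>m\<^sup>+\<^sup>1 U\<^sup>k\<close>. From \<open>T\<^sup>n = 0\<close> one descends to \<open>U\<^sup>2\<^sup>n = 0\<close>.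
\<close>

lemma nilpotent_lbracket:
  assumes T: "graded t T" and "nilpotent T"
  shows "nilpotent (lbracket s a T)"
proof -
  let ?U = "lbracket s a T" and ?L = "lmul s a"
  let ?V = "lbracket s a ?U"
  have U: "graded (s + t) ?U" by (rule graded_lbracket[OF T])
  have V: "graded (s + (s + t)) ?V" by (rule graded_lbracket[OF U])
  note TnU = graded_commute[OF graded_funpow[OF T] graded_funpow[OF U]]
  have step: "(T ^^ m) ((?U ^^ (k + 2)) x) = 0"
    if hyp: "\<And>x. (T ^^ Suc m) ((?U ^^ k) x) = 0" for m k x
  proof -
    have "0 = ?L ((T ^^ Suc m) ((?U ^^ k) (?U x)))"
      by (simp only: hyp twistedD[OF twisted_lmul])
    also have "\<dots> = (T ^^ Suc m) (?L ((?U ^^ k) (?U x))) + scale [:of_nat (Suc m):] ((T ^^ m) (?U ((?U ^^ k) (?U x))))"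
      by (simp only: lmul_funpow[OF T] diff_Suc_1)
    also have "(T ^^ Suc m) (?L ((?U ^^ k) (?U x))) = 0"
    proof (cases k)
      case 0
      then show ?thesis using hyp by simp
    next
      case (Suc j)
      have "(?U ^^ j) (?V (?U x)) = (?U ^^ k) (?V x)"
        using graded_commute[OF V U, of x] Suc by (simp add: funpow_swap1)
      then show ?thesis
        unfolding lmul_funpow[OF U]
        by (simp only: Suc diff_Suc_1 twistedD[OF graded_twisted[OF graded_funpow[OF T]]] hyp[unfolded Suc])
          simp
    qed
    finally have "(T ^^ m) (?U ((?U ^^ k) (?U x))) = 0"
      by (simp add: scale_const_eq_0 del: of_nat_Suc)
    then show ?thesis by (simp add: funpow_swap1)
  qed
  obtain n where n: "\<And>x. (T ^^ n) x = 0" using assms(2) by (auto simp: nilpotent_def)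
  have "j \<le> n \<Longrightarrow> (T ^^ (n - j)) ((?U ^^ (2 * j)) x) = 0" for j x
  proof (induction j arbitrary: x)
    case 0
    then show ?case using n by simp
  next
    case (Suc j)
    have "Suc (n - Suc j) = n - j" using Suc.prems by simp
    then show ?case using step[of "n - Suc j" "2 * j" x] Suc by simp
  qed
  from this[of n] show ?thesis by (auto simp: nilpotent_def)
qed

end

section \<open>Homogeneous operators are zero or injective\<close>

locale simple_finite_novikov = novikov_char_0 scale lprod
  for scale :: "'k::{alg_closed_field, field_char_0} poly \<Rightarrow> 'v::ab_group_add \<Rightarrow> 'v"
    and lprod :: "'v \<Rightarrow> 'v \<Rightarrow> 'v poly" +
  assumes finite: finite_conformal and simple: simple_conformal
begin

lemma simple_cases:
  assumes "subspace I" "\<And>t a x. x \<in> I \<Longrightarrow> lmul t a x \<in> I" "\<And>t b x. x \<in> I \<Longrightarrow> rmul t b x \<in> I"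
  shows "I = {0} \<or> I = UNIV"
  using conformal_idealI[OF assms] simple by (auto simp: simple_conformal_def)

lemma nontrivial: "\<exists>x::'v. x \<noteq> 0"
proof -
  obtain a b where "lprod a b \<noteq> 0" using simple by (auto simp: simple_conformal_def)
  then show ?thesis by (metis poly_eqI coeff_0)
qed

text \<open>
  The torsion elements form an ideal, and a torsion element multiplies trivially: if \<open>h a = 0\<close>
  then \<open>h(-\<lambda>) (a \<circ>\<^bsub>(\<lambda>)\<^esub> b) = 0\<close>. So they cannot fill \<open>V\<close>.
\<close>

lemma torsion_free:
  assumes "scale h x = 0" and "h \<noteq> 0"
  shows "x = 0"
proof -
  define I where "I = {x. \<exists>h. h \<noteq> 0 \<and> scale h x = 0}"
  have mem: "T x \<in> I" if "x \<in> I" and T: "twisted t T" for x t T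
  proof -
    obtain h where "h \<noteq> 0" "scale h x = 0" using \<open>x \<in> I\<close> by (auto simp: I_def)
    moreover from this have "scale (pcompose h [:t, 1:]) (T x) = 0"
      using twistedD(2)[OF T, of h x] twistedD(3)[OF T] by simp
    ultimately show ?thesis unfolding I_def using pcompose_eq_0[of h "[:t, 1:]"] by auto
  qed
  have "subspace I"
  proof (rule subspaceI)
    show "0 \<in> I" by (auto simp: I_def intro: exI[of _ 1])
  next
    fix x y assume "x \<in> I" "y \<in> I"
    then obtain h g where h: "h \<noteq> 0" "scale h x = 0" and g: "g \<noteq> 0" "scale g y = 0" by (auto simp: I_def)
    have "scale (h * g) (x + y) = scale g (scale h x) + scale h (scale g y)"
      by (simp add: scale_right_distrib mult.commute)
    then show "x + y \<in> I" using h g unfolding I_def by (auto intro!: exI[of _ "h * g"])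
  next
    fix c x assume "x \<in> I"
    then obtain h where h: "h \<noteq> 0" "scale h x = 0" by (auto simp: I_def)
    have "scale h (scale c x) = scale c (scale h x)" by (simp add: mult.commute)
    then show "scale c x \<in> I" using h unfolding I_def by auto
  qed
  then have "I = {0} \<or> I = UNIV"
    by (rule simple_cases) (blast intro: mem twisted_lmul twisted_rmul)+
  moreover have "I \<noteq> UNIV"
  proof
    assume U: "I = UNIV"
    obtain a b where ab: "lprod a b \<noteq> 0" using simple by (auto simp: simple_conformal_def)
    obtain h where h: "h \<noteq> 0" "scale h a = 0" using U by (auto simp: I_def)
    have "ev [:t:] (lprod a b) = 0" if "poly h (- t) \<noteq> 0" for t
    proof -
      have "scale [:poly h (- t):] (lmul t a b) = 0"
        using lmul_scale[of t h a b] h(2) by (simp add: lmul_def)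
      then show ?thesis using that by (simp add: scale_const_eq_0 lmul_eq_ev)
    qed
    \<comment> \<open>Only \<open>poly h (- t) = 0\<close> leaves room for a nonzero value at \<open>t\<close>.\<close>
    then have "UNIV - uminus ` {t. poly h t = 0} \<subseteq> {t. ev [:t:] (lprod a b) = 0}"
      by (auto simp: image_iff) (metis minus_minus)
    moreover have "finite (uminus ` {t. poly h t = 0})"
      using poly_roots_finite[OF h(1)] by simp
    then have "infinite (UNIV - uminus ` {t. poly h t = 0})"
      using infinite_UNIV_char_0[where 'a='k] finite_Diff2 by blast
    ultimately have "infinite {t. ev [:t:] (lprod a b) = 0}"
      using infinite_super by blast
    then show False using poly_eq_0_if_ev_const_eq_0 ab by blast
  qed
  ultimately show ?thesis using assms by (auto simp: I_def)
qed

lemma finite_generators: obtains B where "finite B" "span B = UNIV"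
  using finite by (auto simp: finite_conformal_def)

lemma locally_nilpotent_imp_nilpotent:
  assumes T: "graded t T" and nil: "\<And>x. \<exists>n. (T ^^ n) x = 0"
  shows "nilpotent T"
proof -
  obtain B where B: "finite B" "span B = UNIV" by (rule finite_generators)
  obtain n where n: "\<And>x. (T ^^ n x) x = 0" using nil by metis
  \<comment> \<open>Some power of \<open>T\<close> kills all generators, and its kernel is a submodule.\<close>
  define N where "N = Max (n ` B)"
  have T0: "(T ^^ k) 0 = 0" for k
    by (rule twistedD(3)[OF graded_twisted[OF graded_funpow[OF T]]])
  have "(T ^^ N) b = 0" if "b \<in> B" for b
  proof -
    have "n b \<le> N" using B that by (simp add: N_def)
    then have "T ^^ N = T ^^ (N - n b) \<circ> T ^^ n b" by (simp flip: funpow_add)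
    then show ?thesis using n T0 by simp
  qed
  then have "span B \<subseteq> {x. (T ^^ N) x = 0}"
    by (intro span_minimal subspace_kernel[OF graded_twisted[OF graded_funpow[OF T]]]) auto
  then show ?thesis using B by (auto simp: nilpotent_def)
qed

text \<open>
  If \<open>V = TV + W\<close>, where \<open>W\<close> is the sum of the other images and is stable under \<open>T\<close>, then
  \<open>V = T\<^sup>mV + W\<close> for all \<open>m\<close>, so \<open>V = W\<close>. In this way the operators are eliminated one by one.
\<close>

lemma nilpotent_images_not_generating:
  assumes "finite A" "\<And>T. T \<in> A \<Longrightarrow> nilpotent T \<and> (\<exists>t. graded t T)"
    and "span (\<Union>T\<in>A. range T) = UNIV"
  shows False
  using assms
proof (induction A rule: finite_induct)
  case empty
  then show ?case using nontrivial by auto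
next
  case (insert T A)
  obtain t n where T: "graded t T" and n: "\<And>x. (T ^^ n) x = 0"
    using insert.prems(1)[of T] by (auto simp: nilpotent_def)
  define W where "W = span (\<Union>T\<in>A. range T)"
  have W: "subspace W" by (simp add: W_def)
  have TW: "T x \<in> W" if "x \<in> W" for x
    unfolding W_def
  proof (rule twisted_image_span[OF graded_twisted[OF T]])
    fix x assume "x \<in> (\<Union>T\<in>A. range T)"
    then obtain S y where S: "S \<in> A" "x = S y" by blast
    obtain s where "graded s S" using insert.prems(1)[of S] S by auto
    then have "T x = S (T y)" using graded_commute[OF T] S by simp
    then show "T x \<in> span (\<Union>T\<in>A. range T)" using S by (auto intro: span_base)
  qed (use that W_def in simp)
  have TnW: "(T ^^ m) x \<in> W" if "x \<in> W" for m x
    using that by (induction m) (simp_all add: TW)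
  have decomp: "\<exists>y. x - T y \<in> W" for x
  proof -
    have "subspace {x. \<exists>y. x - T y \<in> W}" (is "subspace ?S")
    proof (rule subspaceI)
      show "0 \<in> ?S" using subspace_0[OF W] twistedD(3)[OF graded_twisted[OF T]] by (auto intro!: exI[of _ 0])
    next
      fix x y assume "x \<in> ?S" "y \<in> ?S"
      then obtain u v where "x - T u \<in> W" "y - T v \<in> W" by auto
      then have "(x - T u) + (y - T v) \<in> W" by (rule subspace_add[OF W])
      moreover have "(x - T u) + (y - T v) = x + y - T (u + v)"
        by (simp add: twistedD[OF graded_twisted[OF T]])
      ultimately show "x + y \<in> ?S" by auto
    next
      fix c x assume "x \<in> ?S"
      then obtain u where "x - T u \<in> W" by auto
      then have "scale c (x - T u) \<in> W" by (rule subspace_scale[OF W])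
      moreover have "pcompose (pcompose c [:- t, 1:]) [:t, 1:] = c"
        by (simp add: pcompose_assoc[symmetric] pcompose_pCons pcompose_idR)
      then have "scale c (x - T u) = scale c x - T (scale (pcompose c [:- t, 1:]) u)"
        by (simp add: twistedD(2)[OF graded_twisted[OF T]] scale_right_diff_distrib)
      ultimately show "scale c x \<in> ?S" by auto
    qed
    moreover have "(\<Union>T\<in>insert T A. range T) \<subseteq> ?S"
    proof
      fix x assume "x \<in> (\<Union>T\<in>insert T A. range T)"
      then consider y where "x = T y" | "x \<in> W" by (auto simp: W_def intro: span_base)
      then show "x \<in> ?S"
      proof cases
        case 1
        then show ?thesis using subspace_0[OF W] by (auto intro!: exI[of _ y])
      next
        case 2
        then show ?thesis using twistedD(3)[OF graded_twisted[OF T]] by (auto intro!: exI[of _ 0])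
      qed
    qed
    ultimately have "span (\<Union>T\<in>insert T A. range T) \<subseteq> ?S" by (metis span_minimal)
    then show ?thesis using insert.prems(2) by auto
  qed
  have "\<exists>y. x - (T ^^ m) y \<in> W" for x m
  proof (induction m)
    case 0
    show ?case using subspace_0[OF W] by (auto intro!: exI[of _ x])
  next
    case (Suc m)
    then obtain y where y: "x - (T ^^ m) y \<in> W" by blast
    obtain z where z: "y - T z \<in> W" using decomp by blast
    have "(x - (T ^^ m) y) + (T ^^ m) (y - T z) \<in> W"
      by (intro subspace_add[OF W] y TnW z)
    then have "x - (T ^^ Suc m) z \<in> W"
      by (simp add: twistedD[OF graded_twisted[OF graded_funpow[OF T]]] funpow_swap1)
    then show ?case by blast
  qed
  from this[of _ n] have "W = UNIV" by (auto simp: n)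
  then show ?case using insert.IH insert.prems(1) by (auto simp: W_def)
qed

text \<open>
  The images of all homogeneous nilpotent operators span an ideal, by \<open>L(Sy) = S(Ly) + [L, S]y\<close>. If it were
  \<open>V\<close>, finitely many of these images would contain a finite set of generators.
\<close>

lemma graded_nilpotent_eq_0:
  assumes T: "graded t T" and "nilpotent T"
  shows "T x = 0"
proof -
  define G where "G = {T. nilpotent T \<and> (\<exists>t. graded t T)}"
  define I where "I = span (\<Union>T\<in>G. range T)"
  have "I = {0} \<or> I = UNIV"
  proof (rule simple_cases)
    show "subspace I" by (simp add: I_def)
  next
    fix s a x assume "x \<in> I"
    show "lmul s a x \<in> I"
      unfolding I_def
    proof (rule twisted_image_span[OF twisted_lmul])
      fix x assume "x \<in> (\<Union>T\<in>G. range T)"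
      then obtain S y u where S: "nilpotent S" "graded u S" "x = S y" by (auto simp: G_def)
      then have "S \<in> G" "lbracket s a S \<in> G"
        using nilpotent_lbracket[OF S(2,1)] graded_lbracket[OF S(2)] unfolding G_def by blast+
      then have "S (lmul s a y) \<in> I" "lbracket s a S y \<in> I"
        by (auto simp: I_def intro!: span_base)
      then have "S (lmul s a y) + lbracket s a S y \<in> I" by (simp add: I_def span_add)
      then show "lmul s a x \<in> span (\<Union>T\<in>G. range T)" by (simp add: lbracket_def S I_def)
    qed (use \<open>x \<in> I\<close> I_def in simp)
  next
    fix s b x assume "x \<in> I"
    show "rmul s b x \<in> I"
      unfolding I_def
    proof (rule twisted_image_span[OF twisted_rmul])
      fix x assume "x \<in> (\<Union>T\<in>G. range T)"
      then obtain S y u where S: "S \<in> G" "graded u S" "x = S y" by (auto simp: G_def)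
      then have "rmul s b x = S (rmul s b y)" using graded_commute[OF graded_rmul] by simp
      then show "rmul s b x \<in> span (\<Union>T\<in>G. range T)" using S by (auto intro: span_base)
    qed (use \<open>x \<in> I\<close> I_def in simp)
  qed
  moreover have "I \<noteq> UNIV"
  proof
    assume "I = UNIV"
    obtain B where B: "finite B" "span B = UNIV" by (rule finite_generators)
    have "\<exists>F. finite F \<and> F \<subseteq> (\<Union>T\<in>G. range T) \<and> b \<in> span F" for b
    proof -
      have "b \<in> span (\<Union>T\<in>G. range T)" using \<open>I = UNIV\<close> by (simp add: I_def)
      then obtain F r where F: "finite F" "F \<subseteq> (\<Union>T\<in>G. range T)" "b = (\<Sum>a\<in>F. scale (r a) a)"
        unfolding span_explicit by blast
      then have "b \<in> span F" by (auto intro!: span_sum span_scale intro: span_base)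
      then show ?thesis using F by blast
    qed
    then have "\<forall>b. \<exists>F. finite F \<and> F \<subseteq> (\<Union>T\<in>G. range T) \<and> b \<in> span F" by blast
    from choice[OF this] obtain F
      where "\<forall>b. finite (F b) \<and> F b \<subseteq> (\<Union>T\<in>G. range T) \<and> b \<in> span (F b)" ..
    then have F: "finite (F b)" "F b \<subseteq> (\<Union>T\<in>G. range T)" "b \<in> span (F b)" for b
      by simp_all
    have "\<forall>y\<in>\<Union>(F ` B). \<exists>T. T \<in> G \<and> y \<in> range T" 
    proof
      fix y assume "y \<in> \<Union>(F ` B)"
      then obtain b where "y \<in> F b" by auto
      then have "y \<in> (\<Union>T\<in>G. range T)" using F(2)[of b] by (rule rev_subsetD)
      then show "\<exists>T. T \<in> G \<and> y \<in> range T" by (elim UN_E) (intro exI conjI)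
    qed
    from bchoice[OF this] obtain \<tau> where \<tau>: "\<And>y. y \<in> \<Union>(F ` B) \<Longrightarrow> \<tau> y \<in> G \<and> y \<in> range (\<tau> y)" by auto
    define A where "A = \<tau> ` \<Union>(F ` B)"
    have "finite A" using B F(1) by (simp add: A_def)
    moreover have "A \<subseteq> G" using \<tau> by (auto simp: A_def)
    moreover have "span (\<Union>T\<in>A. range T) = UNIV"
    proof -
      have F_A: "F b \<subseteq> (\<Union>T\<in>A. range T)" if "b \<in> B" for b
      proof
        fix y assume "y \<in> F b"
        then have "y \<in> \<Union>(F ` B)" using that by auto
        then show "y \<in> (\<Union>T\<in>A. range T)" using \<tau>[of y] by (auto simp: A_def)
      qed
      have "B \<subseteq> span (\<Union>T\<in>A. range T)"
      proof
        fix b assume "b \<in> B"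
        then have "span (F b) \<subseteq> span (\<Union>T\<in>A. range T)"
          by (intro span_mono F_A)
        then show "b \<in> span (\<Union>T\<in>A. range T)" using F(3)[of b] by (rule subsetD)
      qed
      then have "span B \<subseteq> span (\<Union>T\<in>A. range T)" by (intro span_minimal) auto
      then show ?thesis using B by auto
    qed
    ultimately show False
      using nilpotent_images_not_generating[of A] by (auto simp: G_def)
  qed
  ultimately have "I = {0}" by blast
  moreover have "T x \<in> I" using assms by (auto simp: I_def G_def intro!: span_base)
  ultimately show ?thesis by simp
qed

text \<open>
  The union of the kernels of the powers of \<open>T\<close> is an ideal: if \<open>T\<^sup>n x = 0\<close> then \<open>T\<^sup>n\<^sup>+\<^sup>1 (Lx) = 0\<close> by the power rule. If it
  is \<open>V\<close>, then \<open>T\<close> is nilpotent by finite generation, hence zero.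
\<close>

lemma graded_eq_0_or_inj:
  assumes T: "graded t T" and "T y \<noteq> 0" and "T x = 0"
  shows "x = 0"
proof -
  define K where "K = {x. \<exists>n. (T ^^ n) x = 0}"
  note Tn = twistedD[OF graded_twisted[OF graded_funpow[OF T]]]
  have mono: "(T ^^ (m + n)) x = 0" if "(T ^^ n) x = 0" for m n x
    using that by (simp add: funpow_add Tn)
  have "K = {0} \<or> K = UNIV"
  proof (rule simple_cases)
    show "subspace K"
    proof (rule subspaceI)
      fix x y assume "x \<in> K" "y \<in> K"
      then obtain m n where "(T ^^ m) x = 0" "(T ^^ n) y = 0" by (auto simp: K_def)
      then have "(T ^^ (n + m)) x = 0" "(T ^^ (m + n)) y = 0" using mono by blast+
      then have "(T ^^ (m + n)) (x + y) = 0" by (simp add: Tn add.commute)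
      then show "x + y \<in> K" unfolding K_def by blast
    next
      fix c x assume "x \<in> K"
      then obtain n where "(T ^^ n) x = 0" by (auto simp: K_def)
      then have "(T ^^ n) (scale c x) = 0" by (simp only: Tn(2) scale_zero_right)
      then show "scale c x \<in> K" unfolding K_def by blast
    next
      have "(T ^^ 0) 0 = 0" by simp
      then show "0 \<in> K" unfolding K_def by blast
    qed
  next
    fix s b x assume "x \<in> K"
    then obtain n where "(T ^^ n) x = 0" by (auto simp: K_def)
    then have "(T ^^ n) (rmul s b x) = 0"
      using graded_commute[OF graded_funpow[OF T] graded_rmul, of n s b x] twistedD(3)[OF twisted_rmul] by simp
    then show "rmul s b x \<in> K" unfolding K_def by blast
  next
    fix s a x assume "x \<in> K"
    then obtain n where n: "(T ^^ n) x = 0" by (auto simp: K_def)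
    have "(T ^^ n) (lbracket s a T x) = 0"
      unfolding graded_commute[OF graded_funpow[OF T] graded_lbracket[OF T]] n
      by (rule twistedD(3)[OF graded_twisted[OF graded_lbracket[OF T]]])
    moreover have "(T ^^ Suc n) x = 0" using mono[OF n, of 1] by (simp only: plus_1_eq_Suc)
    ultimately have "(T ^^ Suc n) (lmul s a x) = 0"
      using lmul_funpow[OF T, of s a "Suc n" x] by (simp only: diff_Suc_1 twistedD(3)[OF twisted_lmul] scale_zero_right add_0_right)
    then show "lmul s a x \<in> K" unfolding K_def by blast
  qed
  moreover have "K \<noteq> UNIV"
  proof
    assume "K = UNIV"
    then have "nilpotent T" using locally_nilpotent_imp_nilpotent[OF T] by (auto simp: K_def)
    then show False using graded_nilpotent_eq_0[OF T] assms(2) by simp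
  qed
  moreover have "x \<in> K" using assms(3) unfolding K_def by (intro CollectI exI[of _ "Suc 0"]) simp
  ultimately show ?thesis by blast
qed

end

section \<open>Operators of degree zero are scalars\<close>

lemma degree_diff_shift_le:
  fixes c :: "'a::idom poly"
  shows "degree (c - pcompose c [:s, 1:]) \<le> degree c - 1"
proof (cases "degree c = 0")
  case True
  then obtain a where "c = [:a:]" by (metis degree_eq_zeroE)
  then show ?thesis by simp
next
  case False
  have deg: "degree (pcompose c [:s, 1:]) = degree c" by (simp add: degree_pcompose)
  have "lead_coeff (pcompose c [:s, 1:]) = lead_coeff c" by (simp add: lead_coeff_comp)
  then have "coeff (c - pcompose c [:s, 1:]) (degree c) = 0" by (simp add: deg)
  moreover have "degree (c - pcompose c [:s, 1:]) \<le> degree c" by (simp add: deg degree_diff_le)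
  ultimately have "degree (c - pcompose c [:s, 1:]) < degree c \<or> c - pcompose c [:s, 1:] = 0"
    by (metis leading_coeff_0_iff nat_less_le)
  then show ?thesis by auto
qed

lemma degree_0_if_periodic:
  fixes c :: "'a::field_char_0 poly"
  assumes "pcompose c [:s, 1:] = c" and "s \<noteq> 0"
  shows "degree c = 0"
proof -
  have step: "poly c (s + x) = poly c x" for x
    using arg_cong[OF assms(1), of "\<lambda>p. poly p x"] by (simp add: poly_pcompose)
  have "poly c (of_nat n * s) = poly c 0" for n
    by (induction n) (simp_all add: algebra_simps step)
  then have "range (\<lambda>n. of_nat n * s) \<subseteq> {x. poly (c - [:poly c 0:]) x = 0}" by auto
  moreover have "infinite (range (\<lambda>n. of_nat n * s))"
    using assms(2) by (intro range_inj_infinite injI) simp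
  ultimately have "c - [:poly c 0:] = 0" using poly_roots_finite infinite_super by blast
  then show ?thesis by (metis degree_pCons_0 eq_iff_diff_eq_0)
qed

context conformal_algebra_char_0
begin

text \<open>
  Elimination over the domain \<open>H\<close>, without fractions: to remove the generator \<open>b\<close>, the vector \<open>f\<^sub>i\<close> is replaced by
  \<open>r\<^sub>j f\<^sub>i - r\<^sub>i f\<^sub>j\<close>, where \<open>r\<^sub>i\<close> is the coefficient of \<open>b\<close> in \<open>f\<^sub>i\<close> and \<open>r\<^sub>j \<noteq> 0\<close>.
\<close>

lemma exists_dependence:
  assumes "finite B" and "finite I" and "card B < card I" and "\<And>i. i \<in> I \<Longrightarrow> f i \<in> span B"
  shows "\<exists>c. (\<exists>i\<in>I. c i \<noteq> 0) \<and> (\<Sum>i\<in>I. scale (c i) (f i)) = 0"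
  using assms
proof (induction B arbitrary: I f rule: finite_induct)
  case empty
  then have "I \<noteq> {}" and "\<And>i. i \<in> I \<Longrightarrow> f i = 0" by auto
  then show ?case by (intro exI[of _ "\<lambda>_. 1"]) auto
next
  case (insert b B)
  have "\<forall>i\<in>I. \<exists>r. f i - scale r b \<in> span B"
    using insert.prems(3) by (auto simp: span_insert)
  then obtain r where r: "\<And>i. i \<in> I \<Longrightarrow> f i - scale (r i) b \<in> span B" by metis
  show ?case
  proof (cases "\<forall>i\<in>I. r i = 0")
    case True
    then show ?thesis using r insert.IH[of I f] insert.prems insert.hyps by auto
  next
    case False
    then obtain j where j: "j \<in> I" "r j \<noteq> 0" by blast
    define h where "h i = scale (r j) (f i) - scale (r i) (f j)" for i
    have "h i \<in> span B" if "i \<in> I" for i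
    proof -
      have "scale (r j) (f i - scale (r i) b) - scale (r i) (f j - scale (r j) b) \<in> span B"
        by (intro span_diff span_scale r j that)
      then show ?thesis by (simp add: h_def scale_right_diff_distrib mult.commute)
    qed
    moreover have "card B < card (I - {j})" using insert.prems insert.hyps j by simp
    ultimately obtain c where c: "\<exists>i\<in>I - {j}. c i \<noteq> 0" "(\<Sum>i\<in>I - {j}. scale (c i) (h i)) = 0"
      using insert.IH[of "I - {j}" h] insert.prems(1) by auto
    \<comment> \<open>The coefficient of \<open>f\<^sub>j\<close> collects what the relation between the \<open>h\<^sub>i\<close> contributes to it.\<close>
    define d where "d i = (if i = j then - (\<Sum>i\<in>I - {j}. c i * r i) else c i * r j)" for i
    have "(\<Sum>i\<in>I. scale (d i) (f i)) = scale (d j) (f j) + (\<Sum>i\<in>I - {j}. scale (d i) (f i))"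
      by (rule sum.remove[OF insert.prems(1) j(1)])
    also have "(\<Sum>i\<in>I - {j}. scale (d i) (f i)) = (\<Sum>i\<in>I - {j}. scale (c i) (h i) + scale (c i * r i) (f j))"
      by (intro sum.cong) (auto simp: d_def h_def scale_right_diff_distrib)
    also have "\<dots> = scale (\<Sum>i\<in>I - {j}. c i * r i) (f j)"
      by (simp add: sum.distrib c(2) scale_sum_left)
    finally have "(\<Sum>i\<in>I. scale (d i) (f i)) = 0" by (simp add: d_def)
    moreover have "\<exists>i\<in>I. d i \<noteq> 0" using c(1) j by (auto simp: d_def)
    ultimately show ?thesis by blast
  qed
qed

text \<open>
  The action on \<open>V\<close> of the polynomial \<open>P(\<partial>, y) \<in> H[y]\<close> with \<open>y\<close> acting as \<open>T\<close>.
\<close>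

definition act :: "('v \<Rightarrow> 'v) \<Rightarrow> 'k poly poly \<Rightarrow> 'v \<Rightarrow> 'v"
  where "act T P x = (\<Sum>i\<le>degree P. scale (coeff P i) ((T ^^ i) x))"

lemma act_bound:
  assumes "degree P \<le> N"
  shows "act T P x = (\<Sum>i\<le>N. scale (coeff P i) ((T ^^ i) x))"
  unfolding act_def by (rule sum.mono_neutral_left) (use assms in \<open>auto simp: coeff_eq_0\<close>)

lemma act_0 [simp]: "act T 0 x = 0"
  by (simp add: act_def)

lemma twisted_0_scale: "twisted 0 T \<Longrightarrow> T (scale h x) = scale h (T x)"
  using twistedD(2)[of 0 T h x] pcompose_idR[of h] by simp

lemma twisted_0_sum: "twisted t T \<Longrightarrow> T (sum f A) = (\<Sum>i\<in>A. T (f i))"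
  by (induction A rule: infinite_finite_induct) (simp_all add: twistedD[of t T])

lemma act_pCons:
  assumes "twisted 0 T"
  shows "act T (pCons c P) x = scale c x + T (act T P x)"
proof -
  have "act T (pCons c P) x = (\<Sum>i\<le>Suc (degree P). scale (coeff (pCons c P) i) ((T ^^ i) x))"
    by (rule act_bound) (simp add: degree_pCons_le)
  also have "\<dots> = scale c x + T (act T P x)"
    by (simp add: sum.atMost_Suc_shift act_def twisted_0_sum[OF assms] twisted_0_scale[OF assms] del: sum.atMost_Suc)
  finally show ?thesis .
qed

lemma act_add: "act T (P + Q) x = act T P x + act T Q x"
proof -
  define N where "N = max (degree P) (degree Q)"
  have "degree P \<le> N" "degree Q \<le> N" "degree (P + Q) \<le> N"
    by (auto simp: N_def intro: degree_add_le)
  then show ?thesis by (simp add: act_bound scale_left_distrib sum.distrib)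
qed

lemma act_diff: "act T (P - Q) x = act T P x - act T Q x"
  using act_add[of T "P - Q" Q x] by simp

lemma act_smult: "act T (smult c P) x = scale c (act T P x)"
  using act_bound[of "smult c P" "degree P" T x] by (simp add: act_def scale_sum_right degree_smult_le)

lemma act_mult:
  assumes "twisted 0 T"
  shows "act T (P * Q) x = act T P (act T Q x)"
  by (induction P) (simp_all add: act_pCons[OF assms] act_add act_smult)

lemma twisted_act:
  assumes "twisted 0 T"
  shows "twisted 0 (act T P)"
proof (induction P)
  case 0
  show ?case by (simp add: twisted_def)
next
  case (pCons c P)
  have "twisted 0 (scale c)"
    unfolding twisted_def pcompose_idR by (simp add: scale_right_distrib mult.commute)
  moreover have "twisted 0 (\<lambda>x. T (act T P x))"
    using twisted_comp[OF assms pCons.IH] by simp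
  moreover have "act T (pCons c P) = (\<lambda>x. scale c x + T (act T P x))"
    by (rule ext) (rule act_pCons[OF assms])
  ultimately show ?case using twisted_add by simp
qed

text \<open>
  Moving \<open>P(\<partial>, T)\<close> past an operator with \<open>S\<partial> = (\<partial> + s)S\<close> that commutes with \<open>T\<close> shifts \<open>\<partial>\<close> by \<open>s\<close>.
\<close>

lemma act_shift:
  assumes "twisted 0 T" and "twisted s S" and "\<And>x. S (T x) = T (S x)"
  shows "S (act T (map_poly (\<lambda>c. pcompose c [:- s, 1:]) P) x) = act T P (S x)"
proof (induction P)
  case 0
  then show ?case by (simp add: twistedD[OF assms(2)])
next
  case (pCons c P)
  have "pcompose (pcompose c [:- s, 1:]) [:s, 1:] = c"
    by (simp add: pcompose_assoc[symmetric] pcompose_pCons pcompose_idR)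
  then show ?case
    by (simp add: map_poly_pCons act_pCons[OF assms(1)] twistedD[OF assms(2)] assms(3) pCons.IH)
qed

end

context simple_finite_novikov
begin

text \<open>
  Each generator is killed by some \<open>P(\<partial>, T)\<close>, as its images under the powers of \<open>T\<close> are
  dependent over \<open>H\<close>. The product of these
  polynomials kills \<open>V\<close>.
\<close>

lemma exists_annihilating_polynomial:
  assumes T: "twisted 0 T"
  shows "\<exists>P. P \<noteq> 0 \<and> (\<forall>x. act T P x = 0)"
proof -
  obtain B where B: "finite B" "span B = UNIV" by (rule finite_generators)
  have "\<exists>P. P \<noteq> 0 \<and> act T P x = 0" for x
  proof -
    define N where "N = card B"
    obtain c where c: "\<exists>i\<in>{..N}. c i \<noteq> 0" "(\<Sum>i\<le>N. scale (c i) ((T ^^ i) x)) = 0"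
      using exists_dependence[OF B(1), of "{..N}" "\<lambda>i. (T ^^ i) x"] B(2) by (auto simp: N_def)
    define P where "P = (\<Sum>i\<le>N. monom (c i) i)"
    have coeff: "coeff P i = (if i \<le> N then c i else 0)" for i
      by (simp add: P_def coeff_sum coeff_monom sum.delta)
    then have "degree P \<le> N" by (intro degree_le) simp
    then have "act T P x = 0" using c(2) by (simp add: act_bound coeff)
    moreover have "P \<noteq> 0" using c(1) coeff by (metis atMost_iff coeff_0)
    ultimately show ?thesis by blast
  qed
  then obtain P where P: "\<And>x. P x \<noteq> 0" "\<And>x. act T (P x) x = 0" by metis
  define Q where "Q = (\<Prod>b\<in>B. P b)"
  have "act T Q b = 0" if "b \<in> B" for b
  proof -
    have "Q = (\<Prod>b\<in>B - {b}. P b) * P b" using B(1) that by (simp add: Q_def prod.remove mult.commute)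
    then show ?thesis by (simp add: act_mult[OF T] P twistedD(3)[OF twisted_act[OF T]])
  qed
  then have "span B \<subseteq> {x. act T Q x = 0}"
    by (intro span_minimal subspace_kernel[OF twisted_act[OF T]]) auto
  moreover have "Q \<noteq> 0" using B(1) P(1) by (simp add: Q_def)
  ultimately show ?thesis using B(2) by auto
qed

lemma exists_generic_rmul: "\<exists>b x. finite {t. rmul t b x = 0}"
proof -
  obtain x b where xb: "lprod x b \<noteq> 0" using simple by (auto simp: simple_conformal_def)
  obtain p where p: "\<And>t. rmul t b x = ev [:t:] p" using rmul_eq_ev by blast
  have "p \<noteq> 0"
  proof
    assume "p = 0"
    then have "coeff (lprod x b) n \<in> {0}" for n
      by (intro coeff_mem_if_rmul_mem) (simp_all add: p subspace_def)
    then show False using xb by (metis poly_eqI coeff_0 singletonD)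
  qed
  then have "finite {t. rmul t b x = 0}"
    using poly_eq_0_if_ev_const_eq_0[of p] unfolding p by blast
  then show ?thesis by blast
qed

text \<open>
  For a suitable \<open>b\<close> the operator \<open>R\<^sub>u b\<close> is nonzero except for finitely many \<open>u\<close>; such exceptions are avoided
  by writing \<open>t\<close> as the sum of two other degrees.
\<close>

lemma graded_exists: "\<exists>T. graded t T \<and> (\<forall>x. T x = 0 \<longrightarrow> x = 0)"
proof -
  obtain b y where fin: "finite {t. rmul t b y = 0}" using exists_generic_rmul by blast
  \<comment> \<open>\<open>u\<close> has to avoid the exceptions for \<open>R\<^sub>u b\<close> and for \<open>R\<^sub>t\<^sub>-\<^sub>u b\<close>.\<close>
  have "finite ({u. rmul u b y = 0} \<union> (\<lambda>u. t - u) ` {u. rmul u b y = 0})" using fin by simp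
  then obtain u where u: "u \<notin> {u. rmul u b y = 0} \<union> (\<lambda>u. t - u) ` {u. rmul u b y = 0}"
    using ex_new_if_finite[OF infinite_UNIV_char_0] by blast
  then have "rmul u b y \<noteq> 0" "rmul (t - u) b y \<noteq> 0"
    by (auto simp: image_iff)
  then have "\<forall>x. rmul (t - u) b (rmul u b x) = 0 \<longrightarrow> x = 0"
    using graded_eq_0_or_inj[OF graded_rmul] by blast
  moreover have "graded t (\<lambda>x. rmul (t - u) b (rmul u b x))"
    using graded_comp[OF graded_rmul[of "t - u" b] graded_rmul[of u b]] by simp
  ultimately show ?thesis by blast
qed

text \<open>
  Among the annihilating polynomials of \<open>T\<close> take one of least degree in \<open>\<partial>\<close>. Its shift by \<open>\<partial> \<mapsto> \<partial> - 1\<close> is also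
  annihilating, since an injective operator of degree \<open>1\<close> intertwines the two. If the degree in \<open>\<partial>\<close> were
  positive, the difference would have smaller degree in \<open>\<partial>\<close> and so be zero; but then the coefficients
  would be periodic, that is, constant.
\<close>

lemma exists_constant_annihilating_polynomial:
  assumes T: "graded 0 T"
  shows "\<exists>p. p \<noteq> 0 \<and> (\<forall>x. act T (map_poly (\<lambda>c. [:c:]) p) x = 0)"
proof -
  have T0: "twisted 0 T" by (rule graded_twisted[OF T])
  define Q where "Q d \<longleftrightarrow> (\<exists>P. P \<noteq> 0 \<and> (\<forall>x. act T P x = 0) \<and> (\<forall>i. degree (coeff P i) \<le> d))" for d
  obtain P where P: "P \<noteq> 0" "\<And>x. act T P x = 0" using exists_annihilating_polynomial[OF T0] by blast
  have "degree (coeff P i) \<le> Max ((\<lambda>i. degree (coeff P i)) ` {..degree P})" for i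
    by (cases "i \<le> degree P") (auto simp: coeff_eq_0)
  then have "\<exists>d. Q d" using P unfolding Q_def by blast
  then have least: "Q (LEAST d. Q d)" by (rule LeastI_ex)
  then obtain P where P: "P \<noteq> 0" "\<And>x. act T P x = 0" and deg: "\<And>i. degree (coeff P i) \<le> (LEAST d. Q d)"
    unfolding Q_def by blast
  have "(LEAST d. Q d) = 0"
  proof (rule ccontr)
    assume "(LEAST d. Q d) \<noteq> 0"
    then obtain e where e: "(LEAST d. Q d) = Suc e" using not0_implies_Suc by blast
    have not_e: "\<not> Q e" using not_less_Least[of e Q] e by simp
    have not_0: "\<not> Q 0" using not_less_Least[of 0 Q] e by simp
    obtain S where S: "graded 1 S" "\<And>x. S x = 0 \<Longrightarrow> x = 0" using graded_exists by blast
    define R where "R = P - map_poly (\<lambda>c. pcompose c [:- 1, 1:]) P"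
    have "act T (map_poly (\<lambda>c. pcompose c [:- 1, 1:]) P) x = 0" for x
    proof (rule S(2))
      show "S (act T (map_poly (\<lambda>c. pcompose c [:- 1, 1:]) P) x) = 0"
        using act_shift[OF T0 graded_twisted[OF S(1)] graded_commute[OF S(1) T]] P(2) by simp
    qed
    then have "act T R x = 0" for x by (simp add: R_def act_diff P)
    moreover have R: "coeff R i = coeff P i - pcompose (coeff P i) [:- 1, 1:]" for i
      by (simp add: R_def coeff_map_poly)
    then have "degree (coeff R i) \<le> e" for i
      using degree_diff_shift_le[of "coeff P i" "- 1"] deg[of i] e by simp
    ultimately have "R = 0" using not_e unfolding Q_def by blast
    then have "degree (coeff P i) = 0" for i
      using R[of i] by (intro degree_0_if_periodic[of _ "- 1"]) simp_all
    then show False using not_0 P unfolding Q_def by auto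
  qed
  then have "degree (coeff P i) = 0" for i using deg[of i] by simp
  then have "P = map_poly (\<lambda>c. [:c:]) (map_poly (\<lambda>c. coeff c 0) P)"
    by (intro poly_eqI) (auto simp: coeff_map_poly coeff_pCons coeff_eq_0 split: nat.splits)
  then show ?thesis using P by (metis map_poly_0)
qed

text \<open>
  A root \<open>c\<close> of an annihilating polynomial of least degree is an eigenvalue, so \<open>T - c\<close> is homogeneous and not
  injective.
\<close>

lemma graded_0_scalar:
  assumes T: "graded 0 T"
  shows "\<exists>c. \<forall>x. T x = scale [:c:] x"
proof -
  have T0: "twisted 0 T" by (rule graded_twisted[OF T])
  define K where "K p \<longleftrightarrow> p \<noteq> 0 \<and> (\<forall>x. act T (map_poly (\<lambda>c. [:c:]) p) x = 0)" for p
  obtain p where p: "K p" and min: "\<And>q. degree q < degree p \<Longrightarrow> \<not> K q"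
    using exists_constant_annihilating_polynomial[OF T] ex_has_least_nat[of K _ degree] unfolding K_def
    by (metis linorder_not_less)
  have "degree p \<noteq> 0"
  proof
    assume "degree p = 0"
    then obtain c where c: "p = [:c:]" by (metis degree_eq_zeroE)
    then have "c \<noteq> 0" "\<forall>x. scale [:c:] x = 0"
      using p by (auto simp: K_def map_poly_pCons act_pCons[OF T0] twistedD(3)[OF T0])
    then show False using nontrivial by (auto simp: scale_const_eq_0)
  qed
  then obtain c where "poly p c = 0" using alg_closed_imp_poly_has_root by blast
  then obtain q where q: "p = [:- c, 1:] * q" by (auto simp: poly_eq_0_iff_dvd)
  have "q \<noteq> 0" using p q by (auto simp: K_def)
  moreover have "degree p = degree [:- c, 1:] + degree q"
    unfolding q using \<open>q \<noteq> 0\<close> by (intro degree_mult_eq) simp_all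
  ultimately have "degree q < degree p" by simp
  then obtain x where x: "act T (map_poly (\<lambda>c. [:c:]) q) x \<noteq> 0"
    using min[of q] \<open>q \<noteq> 0\<close> by (auto simp: K_def)
  have "map_poly (\<lambda>c. [:c:]) p = pCons 0 (map_poly (\<lambda>c. [:c:]) q) - smult [:c:] (map_poly (\<lambda>c. [:c:]) q)"
    unfolding q by (intro poly_eqI) (simp add: coeff_map_poly coeff_pCons split: nat.splits)
  then have "T (act T (map_poly (\<lambda>c. [:c:]) q) x) - scale [:c:] (act T (map_poly (\<lambda>c. [:c:]) q) x) = 0"
    using p by (simp add: K_def act_diff act_pCons[OF T0] act_smult)
  moreover have "graded 0 (\<lambda>x. T x - scale [:c:] x)"
    by (intro graded_diff T graded_scale graded_id)
  ultimately have "T x - scale [:c:] x = 0" for x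
    using graded_eq_0_or_inj[of 0 "\<lambda>x. T x - scale [:c:] x"] x by blast
  then show ?thesis by auto
qed

text \<open>
  With \<open>U\<close> injective of the opposite degree, \<open>US\<close> and \<open>UT\<close> are both scalars.
\<close>

lemma graded_proportional:
  assumes S: "graded t S" "S y \<noteq> 0" and T: "graded t T"
  shows "\<exists>c. \<forall>x. T x = scale [:c:] (S x)"
proof -
  obtain U where U: "graded (- t) U" "\<And>x. U x = 0 \<Longrightarrow> x = 0" using graded_exists by blast
  obtain s where s: "\<And>x. U (S x) = scale [:s:] x"
    using graded_0_scalar graded_comp[OF U(1) S(1)] by fastforce
  obtain r where r: "\<And>x. U (T x) = scale [:r:] x"
    using graded_0_scalar graded_comp[OF U(1) T] by fastforce
  have "s \<noteq> 0" using s[of y] U(2)[of "S y"] S(2) by auto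
  have "U (T x - scale [:r / s:] (S x)) = 0" for x
    using \<open>s \<noteq> 0\<close> by (simp only: twistedD[OF graded_twisted[OF U(1)]] s r) simp
  then show ?thesis using U(2) by (metis eq_iff_diff_eq_0)
qed

lemma graded_surj:
  assumes S: "graded t S" "S y \<noteq> 0"
  shows "\<exists>z. S z = x"
proof -
  obtain U where U: "graded (- t) U" "\<And>x. U x = 0 \<Longrightarrow> x = 0" using graded_exists by blast
  obtain s where s: "\<And>x. U (S x) = scale [:s:] x"
    using graded_0_scalar graded_comp[OF U(1) S(1)] by fastforce
  have "s \<noteq> 0" using s[of y] U(2)[of "S y"] S(2) by auto
  have "S (scale [:inverse s:] (U x)) = scale [:inverse s:] (scale [:s:] x)"
    by (simp only: twistedD(6)[OF graded_twisted[OF S(1)]] graded_commute[OF S(1) U(1)] s)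
  then show ?thesis using scale_inverse_cancel[OF \<open>s \<noteq> 0\<close>] by metis
qed

section \<open>Elements that multiply trivially from the right\<close>

definition rmul_kernel :: "'v set"
  where "rmul_kernel = {a. \<forall>t x. rmul t a x = 0}"

lemma subspace_rmul_kernel: "subspace rmul_kernel"
proof (rule subspaceI)
  show "0 \<in> rmul_kernel" by (simp add: rmul_kernel_def rmul_def)
qed (auto simp: rmul_kernel_def rmul_add_right rmul_scale)

lemma rmul_kernel_lprod: "a \<in> rmul_kernel \<Longrightarrow> lprod b a = 0"
proof -
  assume "a \<in> rmul_kernel"
  then have "coeff (lprod b a) n \<in> {0}" for n
    by (intro coeff_mem_if_rmul_mem) (simp_all add: rmul_kernel_def subspace_def)
  then show ?thesis by (intro poly_eqI) simp
qed

text \<open>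
  Write \<open>[L\<^sub>u a, S] = \<alpha> S\<^sup>2\<close> and \<open>[L\<^sub>2\<^sub>u a, S] = \<beta> S\<^sup>3\<close>, which is possible as the homogeneous operators of a given degree form a
  line. The derivations commute, because \<open>a \<circ>\<^bsub>(\<lambda>)\<^esub> a = 0\<close>. Applying them to \<open>S\<close> in the two orders gives
  \<open>3\<alpha>\<beta> S\<^sup>4\<close> and \<open>2\<alpha>\<beta> S\<^sup>4\<close>, whence \<open>\<alpha>\<beta> = 0\<close>.
\<close>

lemma lbracket_eq_0_dichotomy:
  assumes a: "a \<in> rmul_kernel" and S: "graded u S" "\<And>x. S x = 0 \<Longrightarrow> x = 0"
  shows "\<exists>s\<in>{u, u + u}. \<forall>x. lbracket s a S x = 0"
proof -
  define w where "w = u + u"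
  note S' = twistedD[OF graded_twisted[OF S(1)]]
  obtain z :: 'v where z: "z \<noteq> 0" using nontrivial by blast
  have nz: "S (S z) \<noteq> 0" "S (S (S z)) \<noteq> 0" "S (S (S (S z))) \<noteq> 0" using S(2) z by blast+
  have S2: "graded w (\<lambda>x. S (S x))" using graded_comp[OF S(1) S(1)] by (simp add: w_def)
  have S3: "graded (w + u) (\<lambda>x. S (S (S x)))"
    using graded_comp[OF S(1) S2] by (simp add: add.commute)
  obtain \<alpha> where \<alpha>: "\<And>x. lbracket u a S x = scale [:\<alpha>:] (S (S x))"
    using graded_proportional[OF S2 nz(1)] graded_lbracket[OF S(1), of u a] w_def by blast
  obtain \<beta> where \<beta>: "\<And>x. lbracket w a S x = scale [:\<beta>:] (S (S (S x)))"
    using graded_proportional[OF S3 nz(2) graded_lbracket[OF S(1)]] by blast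
  have L1: "lmul u a (S x) = S (lmul u a x) + scale [:\<alpha>:] (S (S x))" for x
    using \<alpha>[of x] by (simp add: lbracket_def algebra_simps)
  have L2: "lmul w a (S x) = S (lmul w a x) + scale [:\<beta>:] (S (S (S x)))" for x
    using \<beta>[of x] by (simp add: lbracket_def algebra_simps)
  have "lmul t a a = 0" for t using rmul_kernel_lprod[OF a] by (simp add: lmul_eq_ev)
  then have comm: "lmul u a (lmul w a x) = lmul w a (lmul u a x)" for x
    using lmul_commutator[of u a w a x] by (simp add: lmul_def)
  have "lmul u a (lmul w a (S z)) - lmul w a (lmul u a (S z)) =
     scale [:\<alpha> * \<beta>:] (S (S (S (S z))))"
    by (simp add: L1 L2 comm S' twistedD[OF twisted_lmul] scale_right_distrib mult.commute add_ac)
  then have "\<alpha> * \<beta> = 0" using comm nz by (simp add: scale_const_eq_0)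
  then show ?thesis using \<alpha> \<beta> by (auto simp: w_def)
qed

text \<open>
  A derivation that kills \<open>S\<close> of degree \<open>u\<close> kills its powers, and hence \<open>R\<^sub>t c\<close> for every \<open>t = nu\<close>. These are
  infinitely many values of \<open>t\<close>, which suffices for a polynomial in \<open>t\<close>.
\<close>

lemma lmul_mem_rmul_kernel_dichotomy:
  assumes a: "a \<in> rmul_kernel" and "u \<noteq> 0"
  shows "\<exists>s\<in>{u, u + u}. lmul s a c \<in> rmul_kernel"
proof -
  obtain S where S: "graded u S" "\<And>x. S x = 0 \<Longrightarrow> x = 0" using graded_exists by blast
  obtain s where s: "s \<in> {u, u + u}" "\<And>x. lbracket s a S x = 0"
    using lbracket_eq_0_dichotomy[OF a S] by blast
  have "rmul t (lmul s a c) x = 0" for t x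
  proof -
    obtain p where p: "\<And>t. rmul t (lmul s a c) x = ev [:t:] p" using rmul_eq_ev by blast
    have "rmul (s + of_nat n * u) (lmul s a c) x = 0" for n
    proof -
      let ?T = "rmul (of_nat n * u) c"
      obtain z :: 'v where z: "z \<noteq> 0" using nontrivial by blast
      have "(S ^^ n) z \<noteq> 0" using S(2) z by (induction n) auto
      then obtain \<kappa> where \<kappa>: "\<And>x. ?T x = scale [:\<kappa>:] ((S ^^ n) x)"
        using graded_proportional[OF graded_funpow[OF S(1)] _ graded_rmul] by blast
      have "lbracket s a ?T x = scale [:\<kappa>:] (lmul s a ((S ^^ n) x) - (S ^^ n) (lmul s a x))"
        by (simp add: lbracket_def \<kappa> twistedD[OF twisted_lmul] scale_right_diff_distrib)
      also have "\<dots> = 0"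
        using lmul_funpow[OF S(1), of s a n x] s(2) twistedD(3)[OF graded_twisted[OF graded_funpow[OF S(1)]]]
        by simp
      finally show ?thesis
        using a twistedD(3)[OF twisted_rmul] by (simp add: lbracket_rmul rmul_kernel_def)
    qed
    then have "range (\<lambda>n. s + of_nat n * u) \<subseteq> {t. ev [:t:] p = 0}" by (auto simp: p)
    moreover have "infinite (range (\<lambda>n. s + of_nat n * u))"
      using assms(2) by (intro range_inj_infinite injI) simp
    ultimately have "p = 0" using poly_eq_0_if_ev_const_eq_0 infinite_super by blast
    then show ?thesis by (simp add: p)
  qed
  then show ?thesis using s(1) by (auto simp: rmul_kernel_def)
qed

text \<open>
  By the dichotomy, \<open>a \<circ>\<^bsub>(s)\<^esub> c\<close> lies in the kernel for infinitely many \<open>s\<close>, so all coefficients of \<open>a \<circ>\<^bsub>(\<lambda>)\<^esub> c\<close> do, and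
  the kernel is an ideal.
\<close>

lemma rmul_kernel_eq_0: "rmul_kernel = {0}"
proof -
  have "coeff (lprod a c) n \<in> rmul_kernel" if a: "a \<in> rmul_kernel" for a c n
  proof (rule coeff_mem_if_ev_const_mem[OF subspace_imp_k_subspace[OF subspace_rmul_kernel]])
    let ?Z = "{t. ev [:t:] (lprod a c) \<in> rmul_kernel}"
    \<comment> \<open>For \<open>u \<noteq> 0\<close> the dichotomy puts \<open>u\<close> or \<open>2u\<close> into \<open>?Z\<close>, so \<open>?Z\<close> and \<open>?Z/2\<close> cover the rest of \<open>k\<close>.\<close>
    have cover: "UNIV \<subseteq> insert 0 (?Z \<union> (\<lambda>s. s / 2) ` ?Z)"
    proof
      fix u :: 'k
      show "u \<in> insert 0 (?Z \<union> (\<lambda>s. s / 2) ` ?Z)"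
      proof (cases "u = 0")
        case False
        then consider "u \<in> ?Z" | "u + u \<in> ?Z"
          using lmul_mem_rmul_kernel_dichotomy[OF a, of u c] by (auto simp: lmul_eq_ev)
        then show ?thesis
        proof cases
          case 2
          then have "(u + u) / 2 \<in> (\<lambda>s. s / 2) ` ?Z" by blast
          then show ?thesis by simp
        qed simp
      qed simp
    qed
    show "infinite ?Z"
    proof
      assume "finite ?Z"
      then have "finite (insert 0 (?Z \<union> (\<lambda>s. s / 2) ` ?Z))" by simp
      then show False using cover infinite_UNIV_char_0 finite_subset by blast
    qed
  qed
  then have "conformal_ideal rmul_kernel"
    using subspace_rmul_kernel rmul_kernel_lprod subspace_0[OF subspace_rmul_kernel]
    by (auto simp: conformal_ideal_def)
  then have "rmul_kernel = {0} \<or> rmul_kernel = UNIV" using simple by (auto simp: simple_conformal_def)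
  moreover have "rmul_kernel \<noteq> UNIV"
    using simple rmul_kernel_lprod unfolding simple_conformal_def by blast
  ultimately show ?thesis by blast
qed

end

section \<open>Rank one\<close>

context conformal_algebra_char_0
begin

text \<open>
  A functional turns polynomials over \<open>V\<close> into polynomials over \<open>k\<close>, among which ratios can be formed.
\<close>

lemma exists_linear_functional:
  assumes "v \<noteq> 0"
  shows "\<exists>\<phi> :: 'v \<Rightarrow> 'k. (\<forall>x y. \<phi> (x + y) = \<phi> x + \<phi> y) \<and> (\<forall>c x. \<phi> (scale [:c:] x) = c * \<phi> x) \<and> \<phi> v = 1"
proof -
  have V: "vector_space (\<lambda>c. scale [:c:])"
    by unfold_locales (simp_all add: scale_right_distrib scale_const_add scale_one[unfolded one_pCons] mult.commute)
  have K: "vector_space ((*) :: 'k \<Rightarrow> 'k \<Rightarrow> 'k)"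
    by unfold_locales (simp_all add: algebra_simps)
  interpret VK: vector_space_pair "\<lambda>c. scale [:c:]" "(*) :: 'k \<Rightarrow> 'k \<Rightarrow> 'k"
    by (intro vector_space_pair.intro V K)
  have "VK.vs1.independent {v}" using assms by simp
  from VK.linear_independent_extend[OF this, of "\<lambda>_. 1"]
  obtain \<phi> where \<phi>: "Vector_Spaces.linear (\<lambda>c. scale [:c:]) (*) \<phi>" "\<phi> v = 1" by auto
  show ?thesis
    using \<phi> by (intro exI[of _ \<phi>]) (simp add: VK.linear_add VK.linear_scale)
qed

lemma poly_map_functional:
  assumes "\<And>x y. \<phi> (x + y) = \<phi> x + \<phi> y" and "\<And>c x. \<phi> (scale [:c:] x) = c * \<phi> x"
  shows "poly (map_poly \<phi> P) t = \<phi> (ev [:t:] P)"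
proof -
  have \<phi>0: "\<phi> 0 = 0" using assms(1)[of 0 0] by simp
  show ?thesis by (induction P) (simp_all add: map_poly_pCons \<phi>0 assms)
qed

lemma ev_eq_pcompose_scale:
  "ev f (map_poly (\<lambda>c. scale [:c:] v) q) = scale (pcompose q f) v"
  by (induction q) (simp_all add: map_poly_pCons pcompose_pCons scale_left_distrib)

lemma poly_of_multiples:
  assumes "\<And>n. coeff P n \<in> range (\<lambda>c. scale [:c:] v)"
  shows "\<exists>q. P = map_poly (\<lambda>c. scale [:c:] v) q"
  using assms
proof (induction P)
  case 0
  then show ?case by (intro exI[of _ 0]) simp
next
  case (pCons a P)
  have "coeff P n \<in> range (\<lambda>c. scale [:c:] v)" for n using pCons.prems[of "Suc n"] by simp
  then obtain q where q: "P = map_poly (\<lambda>c. scale [:c:] v) q" using pCons.IH by blast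
  obtain c where "a = scale [:c:] v" using pCons.prems[of 0] by auto
  then have "pCons a P = map_poly (\<lambda>c. scale [:c:] v) (pCons c q)" using q by (simp add: map_poly_pCons)
  then show ?case by blast
qed

text \<open>
  By sesqui-linearity the \<open>\<lambda>\<close>-products of a free module of rank one are determined by the square of its generator.
\<close>

lemma isomorphic_rank_oneI:
  assumes gen: "\<And>x. \<exists>h. x = scale h w" and free: "\<And>h. scale h w = 0 \<Longrightarrow> h = 0"
    and prod: "lprod w w = map_poly (\<lambda>h. scale h w) p"
  shows "conformal_isomorphic scale lprod (*) (rank_one_lprod p)"
proof -
  interpret W: conformal_algebra_char_0 "(*) :: 'k poly \<Rightarrow> 'k poly \<Rightarrow> 'k poly" "rank_one_lprod p"
    by (intro conformal_algebra_char_0.intro rank_one_conformal_algebra)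
  define g where "g h = scale h w" for h
  have "inj g"
  proof (rule injI)
    fix h k assume "g h = g k"
    then have "scale (h - k) w = 0" by (simp add: g_def scale_left_diff_distrib)
    then show "h = k" using free by fastforce
  qed
  moreover have "surj g" unfolding g_def using gen by (intro surjI[of _ "\<lambda>x. SOME h. x = scale h w"]) (metis (mono_tags) someI_ex)
  ultimately have "bij g" by (simp add: bij_def)
  define f where "f = inv g"
  have gf: "g (f x) = x" and fg: "f (g h) = h" for x h
    using \<open>bij g\<close> by (simp_all add: f_def bij_def surj_f_inv_f)
  have g0: "g 0 = 0" by (simp add: g_def)
  have f0: "f 0 = 0" using fg[of 0] by (simp add: g0)
  have hom: "module_hom scale (*) f"
  proof -
    have "f (x + y) = f x + f y" for x y
      using fg[of "f x + f y"] by (simp add: g_def scale_left_distrib) (simp add: gf flip: g_def)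
    moreover have "f (scale h x) = h * f x" for h x
      using fg[of "h * f x"] by (simp add: g_def flip: scale_scale) (simp add: gf flip: g_def)
    ultimately show ?thesis
      by (intro module_hom.intro module_hom_axioms.intro module_axioms W.module_axioms)
  qed
  have ev_g: "ev [:t:] (map_poly g r) = g (W.ev [:t:] r)" for t r
    by (induction r) (simp_all add: map_poly_pCons g0 g_def scale_left_distrib)
  have "lprod (g h) (g k) = map_poly g (rank_one_lprod p h k)" for h k
  proof (rule poly_eq_if_ev_const_eq)
    fix t
    have "W.prod_at [:t:] (h * 1) (k * 1) =
        pcompose h (- [:t:]) * (pcompose k ([:t:] + [:0, 1:]) * W.ev [:t:] p)"
      unfolding W.prod_at_scale_left W.prod_at_scale_right
      by (simp only: W.prod_at_def rank_one_lprod_generator mult.left_commute)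
    moreover have "prod_at [:t:] (g h) (g k) =
        scale (pcompose h (- [:t:])) (scale (pcompose k ([:t:] + [:0, 1:])) (ev [:t:] (map_poly g p)))"
      unfolding g_def prod_at_scale_left prod_at_scale_right
      by (simp only: prod_at_def prod scale_scale mult.commute)
    ultimately show "ev [:t:] (lprod (g h) (g k)) = ev [:t:] (map_poly g (rank_one_lprod p h k))"
      unfolding ev_g by (simp add: prod_at_def W.prod_at_def g_def)
  qed
  then have "rank_one_lprod p (f a) (f b) = map_poly f (lprod a b)" for a b
    using gf[of a] gf[of b]
    by (metis (no_types, lifting) coeff_map_poly f0 fg g0 poly_eqI)
  moreover have "bij f" unfolding f_def using \<open>bij g\<close> by (rule bij_imp_bij_inv)
  ultimately show ?thesis unfolding conformal_isomorphic_def using hom by blast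
qed

end

context simple_finite_novikov
begin

text \<open>
  Since \<open>R\<^sub>t b\<close> and \<open>R\<^sub>t c\<close> lie on one line, \<open>\<phi>(R\<^sub>t c x) R\<^sub>t b = \<phi>(R\<^sub>t b x) R\<^sub>t c\<close> for every functional \<open>\<phi>\<close>. The
  coefficients are polynomials in \<open>t\<close>, and \<open>p(t) R\<^sub>t b = R\<^sub>t (p(-\<partial>) b)\<close>; as no nonzero element has all
  its right multiplications zero, this is a relation between \<open>b\<close> and \<open>c\<close>.
\<close>

lemma pairwise_dependent: "\<exists>p q. (p \<noteq> 0 \<or> q \<noteq> 0) \<and> scale p b = scale q c"
proof (cases "c = 0")
  case True
  then show ?thesis by (intro exI[of _ 0] exI[of _ 1]) simp
next
  case False
  then obtain t0 x where "rmul t0 c x \<noteq> 0" using rmul_kernel_eq_0 unfolding rmul_kernel_def by blast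
  then obtain \<phi> :: "'v \<Rightarrow> 'k" where \<phi>: "\<And>x y. \<phi> (x + y) = \<phi> x + \<phi> y"
    "\<And>c x. \<phi> (scale [:c:] x) = c * \<phi> x" "\<phi> (rmul t0 c x) = 1"
    using exists_linear_functional by blast
  obtain P where P: "\<And>t. rmul t c x = ev [:t:] P" using rmul_eq_ev by blast
  obtain Q where Q: "\<And>t. rmul t b x = ev [:t:] Q" using rmul_eq_ev by blast
  define p q where "p = map_poly \<phi> P" and "q = map_poly \<phi> Q"
  have p: "poly p t = \<phi> (rmul t c x)" and q: "poly q t = \<phi> (rmul t b x)" for t
    unfolding p_def q_def P Q by (rule poly_map_functional[OF \<phi>(1,2)])+
  let ?p = "pcompose p [:0, -1:]" and ?q = "pcompose q [:0, -1:]"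
  have "scale ?p b - scale ?q c \<in> rmul_kernel"
    unfolding rmul_kernel_def
  proof safe
    fix t y
    obtain S where S: "graded t S" "\<And>x. S x = 0 \<Longrightarrow> x = 0" using graded_exists by blast
    obtain z :: 'v where "z \<noteq> 0" using nontrivial by blast
    then have "S z \<noteq> 0" using S(2) by blast
    obtain \<kappa> where \<kappa>: "\<And>x. rmul t b x = scale [:\<kappa>:] (S x)"
      using graded_proportional[OF S(1) \<open>S z \<noteq> 0\<close> graded_rmul] by blast
    obtain \<mu> where \<mu>: "\<And>x. rmul t c x = scale [:\<mu>:] (S x)"
      using graded_proportional[OF S(1) \<open>S z \<noteq> 0\<close> graded_rmul] by blast
    have "rmul t (scale ?p b - scale ?q c) y + rmul t (scale ?q c) y = rmul t (scale ?p b) y"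
      by (simp flip: rmul_add_right)
    moreover have "rmul t (scale ?p b) y = rmul t (scale ?q c) y"
      unfolding rmul_scale by (simp add: poly_pcompose p q \<kappa> \<mu> \<phi>(2) mult_ac)
    ultimately show "rmul t (scale ?p b - scale ?q c) y = 0" by simp
  qed
  then have "scale ?p b = scale ?q c" by (simp add: rmul_kernel_eq_0)
  moreover have "p \<noteq> 0" using p[of t0] \<phi>(3) by auto
  then have "?p \<noteq> 0" by (simp add: pcompose_eq_0_iff)
  ultimately show ?thesis by blast
qed

text \<open>
  The Euclidean algorithm: dividing \<open>p\<close> by \<open>q\<close> replaces \<open>p b = q c\<close> by \<open>q (c - k b) = r b\<close>.
\<close>

lemma common_generator:
  assumes "p \<noteq> 0 \<or> q \<noteq> 0" and "scale p b = scale q c"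
  shows "\<exists>w h g. b = scale h w \<and> c = scale g w"
  using assms
\<comment> \<open>The measure treats \<open>0\<close> as smaller than the nonzero constants, as the remainder \<open>r\<close> may be either.\<close>
proof (induction "if q = 0 then 0 else Suc (degree q)" arbitrary: p q b c rule: less_induct)
  case less
  show ?case
  proof (cases "q = 0")
    case True
    then have "b = 0" using less.prems torsion_free[of p b] by simp
    then have "b = scale 0 c" "c = scale 1 c" by simp_all
    then show ?thesis by blast
  next
    case False
    define k r where "k = p div q" and "r = p mod q"
    have p: "p = q * k + r" by (simp add: k_def r_def)
    have "r = 0 \<or> degree r < degree q" unfolding r_def by (rule degree_mod_less[OF False])
    then have small: "(if r = 0 then 0 else Suc (degree r)) < (if q = 0 then 0 else Suc (degree q))"
      using False by auto
    have "scale q (c - scale k b) = scale r b"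
      using less.prems(2) by (simp add: p scale_right_diff_distrib scale_left_distrib algebra_simps)
    then obtain w h g where w: "c - scale k b = scale h w" "b = scale g w"
      using less.hyps[OF small] False by blast
    have "c = scale (h + k * g) w" using w by (simp add: scale_left_distrib algebra_simps)
    then show ?thesis using w(2) by blast
  qed
qed

lemma cyclic: "\<exists>v. \<forall>x. \<exists>h. x = scale h v"
proof -
  obtain B where B: "finite B" "span B = UNIV" by (rule finite_generators)
  have "\<exists>v. B \<subseteq> range (\<lambda>h. scale h v)"
    using B(1)
  proof (induction B rule: finite_induct)
    case (insert b B)
    then obtain v where v: "B \<subseteq> range (\<lambda>h. scale h v)" by blast
    obtain w h g where w: "b = scale h w" "v = scale g w"
      using pairwise_dependent[of b v] common_generator by metis
    have "B \<subseteq> range (\<lambda>h. scale h w)"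
    proof
      fix x assume "x \<in> B"
      then obtain k where "x = scale k v" using v by auto
      then have "x = scale (k * g) w" by (simp add: w)
      then show "x \<in> range (\<lambda>h. scale h w)" by blast
    qed
    then show ?case using w(1) by auto
  qed simp
  then obtain v where "B \<subseteq> range (\<lambda>h. scale h v)" by blast
  moreover have "range (\<lambda>h. scale h v) = span {v}" by (auto simp: span_singleton)
  ultimately have "span B \<subseteq> span {v}" by (intro span_minimal) auto
  then have "x \<in> range (\<lambda>h. scale h v)" for x using B(2) by (auto simp: span_singleton)
  then show ?thesis by (metis rangeE)
qed

text \<open>
  The operator \<open>R\<^sub>t v\<close> is zero or surjective, and it sends \<open>f v\<close> to a multiple of \<open>R\<^sub>t v v = g v\<close>. So \<open>g\<close> is zero or a unit of
  \<open>H\<close>, which means that \<open>R\<^sub>t v v = q(t) v\<close> with \<open>q(t) \<in> k\<close>.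
\<close>

lemma generator_product:
  assumes gen: "\<And>x. \<exists>h. x = scale h v"
  obtains q where "\<And>f. prod_at f v v = scale (pcompose q (- [:0, 1:] - f)) v"
proof -
  have "v \<noteq> 0" using gen nontrivial by (metis scale_zero_right)
  have scalar: "rmul t v v \<in> range (\<lambda>c. scale [:c:] v)" for t
  proof (cases "rmul t v v = 0")
    case True
    then have "rmul t v v = scale [:0:] v" by simp
    then show ?thesis by blast
  next
    case False
    obtain z where z: "rmul t v z = v" using graded_surj[OF graded_rmul False] by blast
    obtain f where f: "z = scale f v" using gen by blast
    obtain g where g: "rmul t v v = scale g v" using gen by blast
    have "scale (pcompose f [:t, 1:] * g - 1) v = 0"
      using z unfolding f twistedD(2)[OF twisted_rmul] g by (simp add: scale_left_diff_distrib)
    then have "pcompose f [:t, 1:] * g - 1 = 0" using torsion_free \<open>v \<noteq> 0\<close> by blast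
    then have "is_unit g" by (metis dvd_triv_right eq_iff_diff_eq_0)
    then have "degree g = 0" using is_unit_iff_degree[of g] not_is_unit_0 by metis
    then obtain c where "g = [:c:]" by (metis degree_eq_zeroE)
    then show ?thesis using g by blast
  qed
  obtain P where P: "\<And>f. ev f P = ev (- [:0, 1:] - f) (lprod v v)" using ev_reversal by metis
  have "ev [:t:] P = rmul t v v" for t by (simp add: P rmul_def prod_at_def)
  moreover have "k_subspace (range (\<lambda>c. scale [:c:] v))"
    unfolding k_subspace_def
  proof (intro conjI ballI allI)
    have "scale [:0:] v = 0" by simp
    then show "0 \<in> range (\<lambda>c. scale [:c:] v)" by (metis rangeI)
  next
    fix x y assume "x \<in> range (\<lambda>c. scale [:c:] v)" "y \<in> range (\<lambda>c. scale [:c:] v)"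
    then show "x + y \<in> range (\<lambda>c. scale [:c:] v)" by (auto simp flip: scale_const_add)
  next
    fix x d assume "x \<in> range (\<lambda>c. scale [:c:] v)"
    then show "scale [:d:] x \<in> range (\<lambda>c. scale [:c:] v)" by auto
  qed
  ultimately have "coeff P n \<in> range (\<lambda>c. scale [:c:] v)" for n
    by (intro coeff_mem_if_ev_const_mem) (simp_all add: scalar infinite_UNIV_char_0)
  then obtain q where "P = map_poly (\<lambda>c. scale [:c:] v) q" using poly_of_multiples by blast
  then have "prod_at f v v = scale (pcompose q (- [:0, 1:] - f)) v" for f
    using P[of "- [:0, 1:] - f"] by (simp add: ev_eq_pcompose_scale prod_at_def)
  then show ?thesis by (rule that)
qed

text \<open>
  The commutator of \<open>L\<^sub>0 v\<close> and \<open>R\<^sub>t v\<close>, applied to \<open>v\<close>, shows that \<open>r(x) - r(x + t)\<close> does not depend on \<open>x\<close>, where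
  \<open>r(x) = q(-x)\<close>. So the derivative of \<open>r\<close> is periodic, hence constant.
\<close>

lemma generator_product_degree:
  assumes gen: "\<And>x. \<exists>h. x = scale h v" 
    and prod: "\<And>f. prod_at f v v = scale (pcompose q (- [:0, 1:] - f)) v"
  shows "q \<noteq> 0" and "degree q \<le> 1"
proof -
  have "v \<noteq> 0" using gen nontrivial by (metis scale_zero_right)
  show "q \<noteq> 0"
  proof
    assume "q = 0"
    then have "prod_at f (scale h v) (scale g v) = 0" for f h g
      by (simp add: prod prod_at_scale_left prod_at_scale_right)
    then have "rmul t b x = 0" for t b x using gen unfolding rmul_def by metis
    then show False using rmul_kernel_eq_0 \<open>v \<noteq> 0\<close> by (auto simp: rmul_kernel_def)
  qed
  then have "finite (insert 0 {t. poly q t = 0})" using poly_roots_finite by simp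
  then obtain t where t: "t \<noteq> 0" "poly q t \<noteq> 0"
    using ex_new_if_finite[OF infinite_UNIV_char_0] by blast
  define c where "c = poly q t"
  define r where "r = pcompose q [:0, -1:]"
  have R: "rmul s v v = scale [:poly q s:] v" for s
  proof -
    have "pcompose q [:s:] = [:poly q s:]" by (induction q) (simp_all add: pcompose_pCons)
    then show ?thesis by (simp add: rmul_def prod)
  qed
  have L: "lmul 0 v v = scale r v" by (simp add: lmul_def prod r_def)
  have "scale [:c:] (scale r v) - scale (pcompose r [:t, 1:]) (scale [:c:] v) =
      scale [:c:] (scale [:c:] v) - scale [:poly q 0:] (scale [:c:] v)"
    using lmul_rmul_commutator[of 0 v t v v]
    by (simp add: R L c_def twistedD(6)[OF twisted_lmul] twistedD(2)[OF twisted_rmul] twistedD(6)[OF twisted_rmul]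
      rmul_scale r_def poly_pcompose del: scale_scale)
  moreover have "scale [:c - poly q 0:] (scale [:c:] v) = scale [:c:] (scale [:c:] v) - scale [:poly q 0:] (scale [:c:] v)"
    using scale_left_diff_distrib[of "[:c:]" "[:poly q 0:]" "scale [:c:] v"] by (simp del: scale_scale)
  ultimately have "scale [:c:] (scale (r - pcompose r [:t, 1:] - [:c - poly q 0:]) v) = 0"
    by (simp add: scale_left_diff_distrib scale_right_diff_distrib mult.commute)
  then have "r - pcompose r [:t, 1:] - [:c - poly q 0:] = 0"
    using t \<open>v \<noteq> 0\<close> torsion_free by (metis c_def pCons_eq_0_iff)
  then have "r - pcompose r [:t, 1:] = [:c - poly q 0:]" by simp
  from arg_cong[OF this, of pderiv] have "pcompose (pderiv r) [:t, 1:] = pderiv r"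
    by (simp add: pderiv_diff pderiv_pcompose pderiv_pCons)
  then have "degree (pderiv r) = 0" using t(1) by (rule degree_0_if_periodic)
  moreover have "degree r = degree q" by (simp add: r_def degree_pcompose)
  ultimately show "degree q \<le> 1" by (simp add: degree_pderiv)
qed

text \<open>
  For \<open>q = a + bt\<close> the generator \<open>w = cv\<close> satisfies \<open>w \<circ>\<^bsub>(\<lambda>)\<^esub> w = c (a - b (\<partial> + \<lambda>)) w\<close>. If \<open>b = 0\<close> this is \<open>w\<close> for
  \<open>c = a\<^sup>-\<^sup>1\<close>, and otherwise it is \<open>(\<partial> + \<lambda> - a/b) w\<close> for \<open>c = -b\<^sup>-\<^sup>1\<close>.
\<close>

lemma isomorphic_cur1_or_valpha:
  "conformal_isomorphic scale lprod (*) cur1_lprod \<or>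
    (\<exists>\<alpha>. conformal_isomorphic scale lprod (*) (valpha_lprod \<alpha>))"
proof -
  obtain v where gen: "\<And>x. \<exists>h. x = scale h v" using cyclic by blast
  obtain q where q: "\<And>f. prod_at f v v = scale (pcompose q (- [:0, 1:] - f)) v"
    using generator_product[OF gen] by blast
  have "v \<noteq> 0" using gen nontrivial by (metis scale_zero_right)
  have "q = [:coeff q 0, coeff q 1:]"
    using generator_product_degree(2)[OF gen q]
    by (intro poly_eqI) (auto simp: coeff_pCons coeff_eq_0 split: nat.splits)
  then obtain a b where ab: "q = [:a, b:]" by blast
  have iso: "conformal_isomorphic scale lprod (*) (rank_one_lprod p)"
    if "c \<noteq> 0" and p: "\<And>t. smult c (pcompose q [:- t, -1:]) = poly p [:t:]" for c p
  proof -
    define w where "w = scale [:c:] v"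
    show ?thesis
    proof (rule isomorphic_rank_oneI)
      fix x
      obtain h where "x = scale h v" using gen by blast
      then have "x = scale (h * [:inverse c:]) w" using \<open>c \<noteq> 0\<close>
        by (simp add: w_def scale_inverse_cancel del: mult_pCons_right flip: scale_scale)
      then show "\<exists>h. x = scale h w" by blast
    next
      fix h assume "scale h w = 0"
      then show "h = 0" using torsion_free \<open>c \<noteq> 0\<close> \<open>v \<noteq> 0\<close> scale_const_eq_0 unfolding w_def by blast
    next
      show "lprod w w = map_poly (\<lambda>h. scale h w) p"
      proof (rule poly_eq_if_ev_const_eq)
        fix t
        have "ev [:t:] (map_poly (\<lambda>h. scale h w) p) = scale (poly p [:t:]) w"
          by (induction p) (simp_all add: map_poly_pCons scale_left_distrib)
        moreover have "ev [:t:] (lprod w w) = scale (smult c (pcompose q [:- t, -1:])) w"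
          using q[of "[:t:]"] unfolding prod_at_def[symmetric] w_def
          by (simp add: prod_at_scale_left prod_at_scale_right mult.commute)
        ultimately show "ev [:t:] (lprod w w) = ev [:t:] (map_poly (\<lambda>h. scale h w) p)"
          by (simp add: p)
      qed
    qed
  qed
  show ?thesis
  proof (cases "b = 0")
    case True
    then have "a \<noteq> 0" using generator_product_degree(1)[OF gen q] ab by auto
    have "conformal_isomorphic scale lprod (*) (rank_one_lprod 1)"
      by (rule iso[of "inverse a"]) (use True \<open>a \<noteq> 0\<close> ab in \<open>simp_all add: one_pCons\<close>)
    then show ?thesis by (simp add: cur1_lprod_def)
  next
    case False
    have "conformal_isomorphic scale lprod (*) (rank_one_lprod [:[:- a / b, 1:], 1:])"
      by (rule iso[of "- inverse b"]) (use False ab in \<open>simp_all add: pcompose_pCons field_simps\<close>)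
    then have "conformal_isomorphic scale lprod (*) (valpha_lprod (- a / b))"
      by (simp add: valpha_lprod_def[abs_def])
    then show ?thesis by blast
  qed
qed

end

theorem corollary3:
  fixes scale :: "'k::{alg_closed_field, field_char_0} poly \<Rightarrow> 'v::ab_group_add \<Rightarrow> 'v"
    and lprod :: "'v \<Rightarrow> 'v \<Rightarrow> 'v poly"
  assumes "novikov_conformal_algebra scale lprod"
    and "conformal_algebra.finite_conformal scale"
    and "conformal_algebra.simple_conformal scale lprod"
  shows "conformal_isomorphic scale lprod (*) cur1_lprod \<or>
    (\<exists>\<alpha>. conformal_isomorphic scale lprod (*) (valpha_lprod \<alpha>))"
proof -
  interpret simple_finite_novikov scale lprod
    using assms by (intro simple_finite_novikov.intro novikov_char_0.intro simple_finite_novikov_axioms.intro)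
  show ?thesis by (rule isomorphic_cur1_or_valpha)
qed

end
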